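(* Let $\mathcal{V}$ be a Banach space with $\dim(\mathcal{V})\ge2$ and $T>0$. When $C^{1-var}([0,T],\mathcal{V})$ is equipped with the $2$-variation norm, the area operator is closable in $1$-variation, but is not closable in $p$-variation for any $p>1$. That is: (i) if $\{\gamma_n\}_n$ and $\{\gamma'_n\}_n$ are two sequences in $C^{1-var}([0,T],\mathcal{V})$ converging in $2$-variation to the same limit, and $\{A(\gamma_n)\}_n$ and $\{A(\gamma'_n)\}_n$ each converge in $1$-variation, then $\{A(\gamma_n)\}_n$ and $\{A(\gamma'_n)\}_n$ converge to the same limit; (ii) for every real $p>1$ there exist two sequences $\{\gamma_n\}_n$ and $\{\gamma'_n\}_n$ in $C^{1-var}([0,T],\mathcal{V})$ converging in $2$-variation to the same limit such that $\{A(\gamma_n)\}_n$ and $\{A(\gamma'_n)\}_n$ each converge in $p$-variation, but to different limits.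
   Context: Let $\triangle_{[0,T]}=\{(s,t):0\le s\le t\le T\}$. For $p>0$ and a continuous function $\alpha$ on $\triangle_{[0,T]}$ with values in a Banach space and $\alpha(t,t)=0$, $\|\alpha\|_{p-var,[0,T]}=(\sup_D\sum_j\|\alpha(t_j,t_{j+1})\|^p)^{1/p}$, the sup being over all finite partitions $D=\{t_j\}$ of $[0,T]$; for a continuous path $\gamma:[0,T]\to\mathcal{V}$, $\|\gamma\|_{p-var}$ is the $p$-variation of $(s,t)\mapsto\gamma(t)-\gamma(s)$. $C^{1-var}([0,T],\mathcal{V})$ is the set of continuous paths of finite $1$-variation. $\mathcal{V}\otimes\mathcal{V}$ is the completion of the algebraic tensor product in a norm satisfying $\|v\otimes u\|\le\|v\|\|u\|$; $[v_1,v_2]=v_1\otimes v_2-v_2\otimes v_1$; $[\mathcal{V},\mathcal{V}]$ is the closure in $\mathcal V\otimes\mathcal V$ of the span of all $[v_1,v_2]$. The area operator sends $\gamma\in C^{1-var}([0,T],\mathcal{V})$ to its area $A(\gamma):\triangle_{[0,T]}\to[\mathcal V,\mathcal V]$, $A(\gamma)(s,t)=\frac12\iint_{s<u_1<u_2<t}[d\gamma(u_1),d\gamma(u_2)]$. *)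

theory Defs
  imports "HOL-Analysis.Analysis" "HOL-Analysis.Finite_Function_Topology"
begin

section \<open>Dimension\<close>

text \<open>The library's \<open>dim\<close> is a natural number and takes a junk value on
  infinite-dimensional spaces.\<close>

definition vdim :: "'a::real_vector itself \<Rightarrow> enat" where
  "vdim _ = (if \<exists>B::'a set. finite B \<and> span B = UNIV then enat (dim (UNIV :: 'a set)) else \<infinity>)"


section \<open>Tensor products\<close>

text \<open>The algebraic tensor product is the free real vector space on pairs modulo the
  span of the bilinearity relations.\<close>

definition tensor_relations ::
  "('a::real_vector \<times> 'b::real_vector, real) poly_mapping set" where
  "tensor_relations =
     {Poly_Mapping.single (a + a', b) 1 - Poly_Mapping.single (a, b) 1
        - Poly_Mapping.single (a', b) 1 | a a' b. True} \<union>
     {Poly_Mapping.single (a, b + b') 1 - Poly_Mapping.single (a, b) 1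
        - Poly_Mapping.single (a, b') 1 | a b b'. True} \<union>
     {Poly_Mapping.single (r *\<^sub>R a, b) 1 - r *\<^sub>R Poly_Mapping.single (a, b) 1 | r a b. True} \<union>
     {Poly_Mapping.single (a, r *\<^sub>R b) 1 - r *\<^sub>R Poly_Mapping.single (a, b) 1 | r a b. True}"

definition tensor_equiv ::
  "('a::real_vector \<times> 'b::real_vector, real) poly_mapping \<Rightarrow> ('a \<times> 'b, real) poly_mapping \<Rightarrow> bool" where
  "tensor_equiv x y \<longleftrightarrow> x - y \<in> span tensor_relations"

quotient_type (overloaded) ('a, 'b) alg_tensor =
  "('a::real_vector \<times> 'b::real_vector, real) poly_mapping" / tensor_equiv
proof (rule equivpI)
  show "reflp (tensor_equiv :: ('a \<times> 'b, real) poly_mapping \<Rightarrow> _)"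
    by (auto simp: reflp_def tensor_equiv_def span_zero)
  show "symp (tensor_equiv :: ('a \<times> 'b, real) poly_mapping \<Rightarrow> _)"
    unfolding symp_def tensor_equiv_def by (auto dest: span_neg)
  show "transp (tensor_equiv :: ('a \<times> 'b, real) poly_mapping \<Rightarrow> _)"
    unfolding transp_def tensor_equiv_def by (auto dest: span_add)
qed

instantiation alg_tensor :: (real_vector, real_vector) real_vector
begin

lift_definition zero_alg_tensor :: "('a, 'b) alg_tensor" is 0 .

lift_definition plus_alg_tensor ::
  "('a, 'b) alg_tensor \<Rightarrow> ('a, 'b) alg_tensor \<Rightarrow> ('a, 'b) alg_tensor" is "(+)"
  unfolding tensor_equiv_def by (drule (1) span_add) (simp add: algebra_simps)

lift_definition uminus_alg_tensor :: "('a, 'b) alg_tensor \<Rightarrow> ('a, 'b) alg_tensor" is uminus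
  unfolding tensor_equiv_def by (drule span_neg) (simp add: algebra_simps)

lift_definition minus_alg_tensor ::
  "('a, 'b) alg_tensor \<Rightarrow> ('a, 'b) alg_tensor \<Rightarrow> ('a, 'b) alg_tensor" is "(-)"
  unfolding tensor_equiv_def
  by (drule (1) span_diff) (simp add: algebra_simps)

lift_definition scaleR_alg_tensor ::
  "real \<Rightarrow> ('a, 'b) alg_tensor \<Rightarrow> ('a, 'b) alg_tensor" is "scaleR"
  unfolding tensor_equiv_def by (drule span_scale) (simp add: scaleR_diff_right)

instance
  by standard (transfer; simp add: tensor_equiv_def span_zero algebra_simps)+

end

lift_definition alg_tensor_of ::
  "'a::real_vector \<Rightarrow> 'b::real_vector \<Rightarrow> ('a, 'b) alg_tensor" (infixr "\<otimes>\<^sub>a" 70)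
  is "\<lambda>a b. Poly_Mapping.single (a, b) 1" .

text \<open>\<open>tensor_completion \<iota>\<close>: the Banach space \<open>'w\<close> is the completion, with canonical map
  \<open>\<iota>\<close>, of the algebraic tensor product in the norm \<open>x \<mapsto> norm (\<iota> x)\<close>, which satisfies
  the required bound on elementary tensors.  Injectivity says that this is a norm and not
  just a seminorm.\<close>

definition tensor_completion ::
  "(('a::real_normed_vector, 'b::real_normed_vector) alg_tensor \<Rightarrow> 'w::banach) \<Rightarrow> bool" where
  "tensor_completion \<iota> \<longleftrightarrow>
     linear \<iota> \<and> inj \<iota> \<and> closure (range \<iota>) = UNIV \<and>
     (\<forall>a b. norm (\<iota> (a \<otimes>\<^sub>a b)) \<le> norm a * norm b)"

definition tbracket ::
  "(('a::real_normed_vector, 'a) alg_tensor \<Rightarrow> 'w::banach) \<Rightarrow> 'a \<Rightarrow> 'a \<Rightarrow> 'w" where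
  "tbracket \<iota> a b = \<iota> (a \<otimes>\<^sub>a b) - \<iota> (b \<otimes>\<^sub>a a)"

definition bracket_space ::
  "(('a::real_normed_vector, 'a) alg_tensor \<Rightarrow> 'w::banach) \<Rightarrow> 'w set" where
  "bracket_space \<iota> = closure (span {tbracket \<iota> a b | a b. True})"


section \<open>\<open>p\<close>-variation\<close>

definition triangle :: "real \<Rightarrow> (real \<times> real) set" where
  "triangle T = {(s, t). 0 \<le> s \<and> s \<le> t \<and> t \<le> T}"

definition partitions :: "real \<Rightarrow> real list set" where
  "partitions T = {D. D \<noteq> [] \<and> sorted_wrt (<) D \<and> hd D = 0 \<and> last D = T}"

definition pvar_sum :: "real \<Rightarrow> (real \<times> real \<Rightarrow> 'b::real_normed_vector) \<Rightarrow> real list \<Rightarrow> real" where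
  "pvar_sum p \<alpha> D = (\<Sum>j<length D - 1. norm (\<alpha> (D ! j, D ! Suc j)) powr p)"

definition pvar :: "real \<Rightarrow> real \<Rightarrow> (real \<times> real \<Rightarrow> 'b::real_normed_vector) \<Rightarrow> ennreal" where
  "pvar p T \<alpha> =
     (let S = (SUP D\<in>partitions T. ennreal (pvar_sum p \<alpha> D))
      in if S = \<infinity> then \<infinity> else ennreal (enn2real S powr (1 / p)))"

definition increments :: "(real \<Rightarrow> 'a::real_normed_vector) \<Rightarrow> real \<times> real \<Rightarrow> 'a" where
  "increments \<gamma> = (\<lambda>(s, t). \<gamma> t - \<gamma> s)"

definition C1var :: "real \<Rightarrow> (real \<Rightarrow> 'a::real_normed_vector) set" where
  "C1var T = {\<gamma>. continuous_on {0..T} \<gamma> \<and> pvar 1 T (increments \<gamma>) < \<infinity>}"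

text \<open>Convergence in \<open>p\<close>-variation of paths, and of \<open>E\<close>-valued functions on the triangle.\<close>

definition path_conv_pvar ::
  "real \<Rightarrow> real \<Rightarrow> (nat \<Rightarrow> real \<Rightarrow> 'a::real_normed_vector) \<Rightarrow> (real \<Rightarrow> 'a) \<Rightarrow> bool" where
  "path_conv_pvar p T \<gamma>s \<gamma> \<longleftrightarrow>
     continuous_on {0..T} \<gamma> \<and>
     (\<lambda>n. pvar p T (increments (\<lambda>t. \<gamma>s n t - \<gamma> t))) \<longlonglongrightarrow> 0"

definition conv_pvar ::
  "real \<Rightarrow> real \<Rightarrow> 'b::real_normed_vector set \<Rightarrow>
   (nat \<Rightarrow> real \<times> real \<Rightarrow> 'b) \<Rightarrow> (real \<times> real \<Rightarrow> 'b) \<Rightarrow> bool" where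
  "conv_pvar p T E \<alpha>s \<alpha> \<longleftrightarrow>
     continuous_on (triangle T) \<alpha> \<and> \<alpha> ` triangle T \<subseteq> E \<and> (\<forall>t\<in>{0..T}. \<alpha> (t, t) = 0) \<and>
     (\<lambda>n. pvar p T (\<lambda>x. \<alpha>s n x - \<alpha> x)) \<longlonglongrightarrow> 0"


section \<open>The area operator\<close>

text \<open>Riemann--Stieltjes integral \<open>\<integral>\<^sub>a\<^sup>b B (f u) (dg u)\<close>; fineness with respect to
  balls of a constant radius expresses that the mesh is small.\<close>

definition has_RS_integral ::
  "('a \<Rightarrow> 'b \<Rightarrow> 'c) \<Rightarrow> (real \<Rightarrow> 'a) \<Rightarrow> (real \<Rightarrow> 'b::real_normed_vector) \<Rightarrow>
   real \<Rightarrow> real \<Rightarrow> 'c::real_normed_vector \<Rightarrow> bool" where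
  "has_RS_integral B f g a b I \<longleftrightarrow>
     (\<forall>\<epsilon>>0. \<exists>\<delta>>0. \<forall>P. P tagged_division_of {a..b} \<and> (\<lambda>x. ball x \<delta>) fine P \<longrightarrow>
        norm ((\<Sum>(x, K)\<in>P. B (f x) (g (Sup K) - g (Inf K))) - I) < \<epsilon>)"

definition RS_integral ::
  "('a \<Rightarrow> 'b \<Rightarrow> 'c) \<Rightarrow> (real \<Rightarrow> 'a) \<Rightarrow> (real \<Rightarrow> 'b::real_normed_vector) \<Rightarrow>
   real \<Rightarrow> real \<Rightarrow> 'c::real_normed_vector" where
  "RS_integral B f g a b = (THE I. has_RS_integral B f g a b I)"

text \<open>The double integral is iterated: for fixed \<open>u\<^sub>2 \<in> (s, t)\<close>, first integrate
  \<open>d\<gamma>(u\<^sub>1)\<close> over \<open>u\<^sub>1 \<in> (s, u\<^sub>2)\<close>, then integrate the bracket against \<open>d\<gamma>(u\<^sub>2)\<close>.\<close>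

definition area ::
  "(('a::real_normed_vector, 'a) alg_tensor \<Rightarrow> 'w::banach) \<Rightarrow>
   (real \<Rightarrow> 'a) \<Rightarrow> real \<times> real \<Rightarrow> 'w" where
  "area \<iota> \<gamma> = (\<lambda>(s, t). (1 / 2) *\<^sub>R
     RS_integral (tbracket \<iota>) (\<lambda>u\<^sub>2. RS_integral scaleR (\<lambda>u\<^sub>1. 1::real) \<gamma> s u\<^sub>2) \<gamma> s t)"

end

theory Submission
  imports Defs
begin

text \<open>(i) Chen's relation passes to the limit, so the difference of the two limits of the areas is
  additive. The area of a path of bounded variation has small \<open>1\<close>-variation sums along fine
  partitions, and this survives convergence in \<open>1\<close>-variation; an additive function with this
  property vanishes.

  (ii) One sequence is constantly zero. The other superposes \<open>n\<close> circles in the plane of two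
  independent vectors, each enclosing area at rate \<open>1 / (2 n)\<close>, with frequencies growing so fast that
  the circles hardly interact. Circles at well separated scales do not add up in the
  \<open>1/2\<close>-Hoelder norm, which is therefore of order \<open>n\<close> to the power \<open>- 1/2\<close>, whereas their area rates
  do add up. The area is uniformly close to the linear function \<open>(t - s) / 2\<close> and of size
  \<open>O(t - s)\<close>, so interpolation gives convergence in \<open>p\<close>-variation for every \<open>p > 1\<close>.\<close>

section \<open>Riemann--Stieltjes integrals against dominated increments\<close>

text \<open>The area of a concrete path is never evaluated from its iterated integral. Chen's
  relation and a bound \<open>C * (t - s)^2\<close> together determine a function on the triangle:
  the difference of two candidates is additive and quadratically small, hence zero. A closed formula
  for one circle, or for a sum of two paths, therefore only has to be checked against these two
  properties. A circle of radius \<open>r\<close> and angular speed \<open>\<omega>\<close> sweeps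
  area at rate \<open>r^2 * \<omega> / 2\<close>. Prescribing \<open>r^2 * \<omega> = \<rho>\<close>
  fixes this rate and caps the Hoelder constant at a multiple of \<open>sqrt \<rho>\<close>, while
  \<open>r\<close> stays free. The speed of the circle is of order \<open>\<rho> / r\<close>, so
  making \<open>r\<close> small ruins the Lipschitz constant of the superposition. The obstacle is
  thus that no error estimate may contain the speed of the newest circle: it may contain only its
  radius and the Lipschitz constant \<open>L\<close> of the path built so far. The radius can then
  be chosen after \<open>L\<close> is known, which is why the circles are added one at a time by
  induction.\<close>

definition dominates :: "(real \<Rightarrow> real) \<Rightarrow> (real \<Rightarrow> 'a::real_normed_vector) \<Rightarrow> real \<Rightarrow> real \<Rightarrow> bool" where
  "dominates v g a b \<longleftrightarrow> (\<forall>s t. a \<le> s \<longrightarrow> s \<le> t \<longrightarrow> t \<le> b \<longrightarrow> norm (g t - g s) \<le> v t - v s)"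

lemma dominatesD: "dominates v g a b \<Longrightarrow> a \<le> s \<Longrightarrow> s \<le> t \<Longrightarrow> t \<le> b \<Longrightarrow> norm (g t - g s) \<le> v t - v s"
  by (simp add: dominates_def)

text \<open>Since norms are nonnegative, a dominating \<open>v\<close> is monotone. It acts as a
  variation function of \<open>g\<close> of which only the increments matter; for an
  \<open>L\<close>-Lipschitz path it is simply \<open>L * t\<close>.\<close>

lemma dominates_mono: "dominates v g a b \<Longrightarrow> a \<le> s \<Longrightarrow> s \<le> t \<Longrightarrow> t \<le> b \<Longrightarrow> v s \<le> v t"
  using dominatesD[of v g a b s t] norm_ge_zero[of "g t - g s"] by linarith

lemma dominates_subset: "dominates v g a b \<Longrightarrow> a \<le> c \<Longrightarrow> d \<le> b \<Longrightarrow> dominates v g c d"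
  by (auto simp: dominates_def)

definition RS_sum :: "('a \<Rightarrow> 'b \<Rightarrow> 'c) \<Rightarrow> (real \<Rightarrow> 'a) \<Rightarrow> (real \<Rightarrow> 'b::real_normed_vector) \<Rightarrow>
    (real \<times> real set) set \<Rightarrow> 'c::real_normed_vector" where
  "RS_sum B f g P = (\<Sum>(x, K)\<in>P. B (f x) (g (Sup K) - g (Inf K)))"

lemma has_RS_integral_alt:
  "has_RS_integral B f g a b I \<longleftrightarrow>
     (\<forall>\<epsilon>>0. \<exists>\<delta>>0. \<forall>P. P tagged_division_of {a..b} \<and> (\<lambda>x. ball x \<delta>) fine P \<longrightarrow>
        norm (RS_sum B f g P - I) < \<epsilon>)"
  unfolding has_RS_integral_def RS_sum_def ..

lemma tagged_division_interval:
  fixes a b :: real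
  assumes "P tagged_division_of {a..b}" "(x, K) \<in> P"
  shows "K = {Inf K..Sup K}" "Inf K \<le> x" "x \<le> Sup K" "a \<le> Inf K" "Sup K \<le> b" "x \<in> K"
proof -
  have x: "x \<in> K" and K: "K \<subseteq> {a..b}" and "\<exists>c d. K = cbox c d"
    using tagged_division_ofD[OF assms(1)] assms(2) by blast+
  then obtain c d where cd: "K = {c..d}" by (auto simp: cbox_interval)
  with x have "c \<le> d" by simp
  with cd x K show "K = {Inf K..Sup K}" "Inf K \<le> x" "x \<le> Sup K" "a \<le> Inf K" "Sup K \<le> b" "x \<in> K"
    by auto
qed

lemma RS_sum_cong:
  assumes "P tagged_division_of {a..b}" "\<And>x. x \<in> {a..b} \<Longrightarrow> f x = f' x"
  shows "RS_sum B f g P = RS_sum B f' g P"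
proof -
  have "f x = f' x" if "(x, K) \<in> P" for x K
    using assms tag_in_interval[OF assms(1) that] by blast
  then show ?thesis unfolding RS_sum_def by (intro sum.cong) auto
qed

lemma has_RS_integral_cong:
  assumes "\<And>x. x \<in> {a..b} \<Longrightarrow> f x = f' x"
  shows "has_RS_integral B f g a b I \<longleftrightarrow> has_RS_integral B f' g a b I"
  unfolding has_RS_integral_alt using RS_sum_cong[of _ a b f f' B g] assms by metis

lemma RS_integral_cong:
  assumes "\<And>x. x \<in> {a..b} \<Longrightarrow> f x = f' x"
  shows "RS_integral B f g a b = RS_integral B f' g a b"
proof -
  have "has_RS_integral B f g a b = has_RS_integral B f' g a b"
    using has_RS_integral_cong[of a b f f' B g] assms by blast
  then show ?thesis by (simp add: RS_integral_def)
qed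

lemma fine_ball_mono: "(\<lambda>x. ball x d) fine P \<Longrightarrow> d \<le> e \<Longrightarrow> (\<lambda>x. ball x e) fine P" for d e :: real
  unfolding fine_def by (force simp: subset_iff)

lemma has_RS_integral_fineE:
  assumes "has_RS_integral B f g a b I" "e > 0"
  obtains d where "d > 0" "\<And>P d'. P tagged_division_of {a..b} \<Longrightarrow> d' \<le> d \<Longrightarrow> (\<lambda>x. ball x d') fine P \<Longrightarrow>
    norm (RS_sum B f g P - I) < e"
proof -
  obtain d where d: "d > 0" "\<And>P. P tagged_division_of {a..b} \<Longrightarrow> (\<lambda>x. ball x d) fine P \<Longrightarrow>
    norm (RS_sum B f g P - I) < e" using assms unfolding has_RS_integral_alt by meson
  show ?thesis
  proof (rule that[OF d(1)])
    show "norm (RS_sum B f g P - I) < e"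
      if "P tagged_division_of {a..b}" "d' \<le> d" "(\<lambda>x. ball x d') fine P" for P d'
      using d(2)[OF that(1) fine_ball_mono[OF that(3,2)]] .
  qed
qed

lemma has_RS_integral_unique:
  assumes "has_RS_integral B f g a b I" "has_RS_integral B f g a b J"
  shows "I = J"
proof -
  have "norm (I - J) < e" if e: "e > 0" for e
  proof -
    have e2: "e/2 > 0" using e by simp
    obtain d1 where d1: "d1 > 0" "\<And>P d'. P tagged_division_of {a..b} \<Longrightarrow> d' \<le> d1 \<Longrightarrow> (\<lambda>x. ball x d') fine P \<Longrightarrow>
      norm (RS_sum B f g P - I) < e/2" using has_RS_integral_fineE[OF assms(1) e2] by metis
    obtain d2 where d2: "d2 > 0" "\<And>P d'. P tagged_division_of {a..b} \<Longrightarrow> d' \<le> d2 \<Longrightarrow> (\<lambda>x. ball x d') fine P \<Longrightarrow>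
      norm (RS_sum B f g P - J) < e/2" using has_RS_integral_fineE[OF assms(2) e2] by metis
    have "min d1 d2 > 0" using d1(1) d2(1) by simp
    then obtain P where P: "P tagged_division_of {a..b}" "(\<lambda>x. ball x (min d1 d2)) fine P"
      using fine_division_exists_real[OF gauge_ball] by blast
    have "norm (RS_sum B f g P - I) < e/2" "norm (RS_sum B f g P - J) < e/2"
      using d1(2)[OF P(1) _ P(2)] d2(2)[OF P(1) _ P(2)] by simp_all
    then show ?thesis
      using dist_triangle_half_r[of "RS_sum B f g P" I e J] by (simp add: dist_norm)
  qed
  then show ?thesis by (metis less_irrefl right_minus_eq zero_less_norm_iff)
qed

lemma RS_integral_eqI: "has_RS_integral B f g a b I \<Longrightarrow> RS_integral B f g a b = I"
  unfolding RS_integral_def using has_RS_integral_unique by blast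

text \<open>Every sum telescopes to the increment exactly, whatever the mesh. This evaluates the
  inner integral of \<open>area\<close>.\<close>

lemma RS_integral_const_one:
  assumes "a \<le> b"
  shows "RS_integral scaleR (\<lambda>_. 1::real) g a b = g b - g a"
proof (rule RS_integral_eqI)
  have "RS_sum scaleR (\<lambda>_. 1::real) g P = g b - g a" if "P tagged_division_of {a..b}" for P
    unfolding RS_sum_def using additive_tagged_division_1[OF assms that, of g] by simp
  then show "has_RS_integral scaleR (\<lambda>_. 1::real) g a b (g b - g a)"
    unfolding has_RS_integral_alt by (intro allI impI exI[of _ 1]) auto
qed

definition clamp_to :: "real set \<Rightarrow> real \<Rightarrow> real" where
  "clamp_to K x = max (Inf K) (min (Sup K) x)"

text \<open>The increment of \<open>g\<close> over \<open>K \<inter> L\<close>, which is zero when \<open>K\<close> and \<open>L\<close> do not meet,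
  is the increment over \<open>L\<close> of \<open>g \<circ> clamp_to K\<close>. This gives sums over the common refinement
  of two tagged divisions without constructing it.\<close>

definition cap_incr :: "(real \<Rightarrow> 'a::real_normed_vector) \<Rightarrow> real set \<Rightarrow> real set \<Rightarrow> 'a" where
  "cap_incr g K L = g (clamp_to K (Sup L)) - g (clamp_to K (Inf L))"

text \<open>For overlapping intervals both sides are the increment over the intersection; otherwise
  clamping collapses both ends to one point and both sides vanish.\<close>

lemma cap_incr_commute:
  assumes "Inf K \<le> Sup K" "Inf L \<le> Sup L"
  shows "cap_incr g K L = cap_incr g L K"
proof -
  consider "Sup L \<le> Inf K" | "Sup K \<le> Inf L" | "Inf K \<le> Sup L" "Inf L \<le> Sup K" by linarith
  then show ?thesis
  proof cases
    case 1
    then have "clamp_to K (Sup L) = Inf K" "clamp_to K (Inf L) = Inf K"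
        "clamp_to L (Sup K) = Sup L" "clamp_to L (Inf K) = Sup L"
      using assms by (auto simp: clamp_to_def)
    then show ?thesis by (simp add: cap_incr_def)
  next
    case 2
    then have "clamp_to K (Sup L) = Sup K" "clamp_to K (Inf L) = Sup K"
        "clamp_to L (Sup K) = Inf L" "clamp_to L (Inf K) = Inf L"
      using assms by (auto simp: clamp_to_def)
    then show ?thesis by (simp add: cap_incr_def)
  next
    case 3
    then have "clamp_to K (Sup L) = clamp_to L (Sup K)" "clamp_to K (Inf L) = clamp_to L (Inf K)"
      using assms by (auto simp: clamp_to_def)
    then show ?thesis by (simp add: cap_incr_def)
  qed
qed

lemma sum_cap_incr:
  assumes "a \<le> b" and Q: "Q tagged_division_of {a..b}" and P: "P tagged_division_of {a..b}"
    and "(x, K) \<in> P"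
  shows "(\<Sum>(y, L)\<in>Q. cap_incr g K L) = g (Sup K) - g (Inf K)"
proof -
  note K = tagged_division_interval[OF P assms(4)]
  have "(\<Sum>(y, L)\<in>Q. cap_incr g K L) = g (clamp_to K b) - g (clamp_to K a)"
    unfolding cap_incr_def using additive_tagged_division_1[OF assms(1) Q, of "g \<circ> clamp_to K"] by simp
  moreover have "clamp_to K b = Sup K" "clamp_to K a = Inf K"
    using K by (auto simp: clamp_to_def)
  ultimately show ?thesis by simp
qed

lemma RS_sum_refine:
  assumes "bounded_bilinear B"
    and "a \<le> b" and P: "P tagged_division_of {a..b}" and Q: "Q tagged_division_of {a..b}"
  shows "RS_sum B f g P = (\<Sum>(x, K)\<in>P. \<Sum>(y, L)\<in>Q. B (f x) (cap_incr g K L))"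
proof -
  interpret B: bounded_bilinear B by fact
  show ?thesis
    unfolding RS_sum_def
  proof (intro sum.cong refl, clarify)
    fix x K assume "(x, K) \<in> P"
    then show "B (f x) (g (Sup K) - g (Inf K)) = (\<Sum>(y, L)\<in>Q. B (f x) (cap_incr g K L))"
      by (simp add: sum_cap_incr[OF assms(2) Q P, symmetric] B.sum_right split_def)
  qed
qed

lemma cap_incr_norm_le:
  assumes v: "dominates v g a b" and P: "P tagged_division_of {a..b}" and Q: "Q tagged_division_of {a..b}"
    and xK: "(x, K) \<in> P" and yL: "(y, L) \<in> Q"
  shows "norm (cap_incr g K L) \<le> cap_incr v K L"
proof -
  note K = tagged_division_interval[OF P xK] and L = tagged_division_interval[OF Q yL]
  show ?thesis unfolding cap_incr_def
    by (rule dominatesD[OF v]) (use K L in \<open>auto simp: clamp_to_def\<close>)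
qed

text \<open>Only overlapping pairs contribute to a refined sum, and the common point
  \<open>z\<close> is what later bounds the distance between the two tags.\<close>

lemma cap_incr_nonzero:
  assumes P: "P tagged_division_of {a..b}" and Q: "Q tagged_division_of {a..b}"
    and xK: "(x, K) \<in> P" and yL: "(y, L) \<in> Q" and "cap_incr g K L \<noteq> 0"
  obtains z where "z \<in> K" "z \<in> L"
proof -
  note K = tagged_division_interval[OF P xK] and L = tagged_division_interval[OF Q yL]
  have "Inf L \<le> Sup K" "Inf K \<le> Sup L"
    using assms(5) K(2,3) L(2,3) by (auto simp: cap_incr_def clamp_to_def max_def min_def split: if_splits)
  then have "max (Inf K) (Inf L) \<in> {Inf K..Sup K}" "max (Inf K) (Inf L) \<in> {Inf L..Sup L}"
    using K(2,3) L(2,3) by auto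
  then show ?thesis using that K(1) L(1) by metis
qed

text \<open>Over the common refinement the difference becomes a sum of terms
  \<open>B (f x - f y)\<close> applied to increments of \<open>g\<close>. A nonzero increment forces
  the tags \<open>x\<close> and \<open>y\<close> to be within \<open>2 * \<delta>\<close>, so the
  oscillation bound applies, and the increments of \<open>v\<close> over the pieces add up to
  \<open>v b - v a\<close>.\<close>

lemma RS_sum_diff_le:
  assumes B: "bounded_bilinear B" and K: "\<And>x y. norm (B x y) \<le> norm x * norm y * K"
    and ab: "a \<le> b" and v: "dominates v g a b" 
    and P: "P tagged_division_of {a..b}" "(\<lambda>x. ball x \<delta>) fine P"
    and Q: "Q tagged_division_of {a..b}" "(\<lambda>x. ball x \<delta>) fine Q"
    and osc: "\<And>x y. x \<in> {a..b} \<Longrightarrow> y \<in> {a..b} \<Longrightarrow> \<bar>x - y\<bar> < 2 * \<delta> \<Longrightarrow> norm (f x - f y) \<le> e"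
    and "K \<ge> 0"
  shows "norm (RS_sum B f g P - RS_sum B f g Q) \<le> e * K * (v b - v a)"
proof -
  interpret B: bounded_bilinear B by fact
  have "RS_sum B f g Q = (\<Sum>(y, L)\<in>Q. \<Sum>(x, K)\<in>P. B (f y) (cap_incr g K L))"
    unfolding RS_sum_refine[OF B ab Q(1) P(1)]
  proof (intro sum.cong refl, clarify, intro sum.cong refl, clarify)
    fix x K y L assume "(y, L) \<in> Q" "(x, K) \<in> P"
    then have "Inf K \<le> Sup K" "Inf L \<le> Sup L"
      using tagged_division_interval(2,3)[OF P(1), of x K] tagged_division_interval(2,3)[OF Q(1), of y L]
      by linarith+
    then show "B (f y) (cap_incr g L K) = B (f y) (cap_incr g K L)"
      using cap_incr_commute by metis
  qed
  also have "\<dots> = (\<Sum>(x, K)\<in>P. \<Sum>(y, L)\<in>Q. B (f y) (cap_incr g K L))"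
    unfolding split_def by (rule sum.swap)
  finally have *: "RS_sum B f g P - RS_sum B f g Q
      = (\<Sum>(x, K)\<in>P. \<Sum>(y, L)\<in>Q. B (f x - f y) (cap_incr g K L))"
    unfolding RS_sum_refine[OF B ab P(1) Q(1)] by (simp add: split_def sum_subtractf B.diff_left)
  have "norm (B (f x - f y) (cap_incr g M L)) \<le> e * K * cap_incr v M L"
    if xM: "(x, M) \<in> P" and yL: "(y, L) \<in> Q" for x y M L
  proof (cases "cap_incr g M L = 0")
    case True
    \<comment> \<open>The increment of \<open>v\<close> can be positive where that of
      \<open>g\<close> vanishes, so the sign of \<open>e\<close> is needed; it is read off from the
      oscillation bound at a single tag.\<close>
    have "0 \<le> norm (f x - f x)" by simp
    also have "... \<le> e"
    proof (rule osc)
      show "x \<in> {a..b}" "x \<in> {a..b}" using tag_in_interval[OF P(1) that(1)] by blast+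
      have "x \<in> ball x \<delta>"
        using P(2) that tagged_division_interval(6)[OF P(1)] unfolding fine_def by blast
      then show "\<bar>x - x\<bar> < 2 * \<delta>" by simp
    qed
    finally have "0 \<le> e" .
    then show ?thesis using cap_incr_norm_le[OF v P(1) Q(1) that] True \<open>K \<ge> 0\<close> by (simp add: B.zero_right)
  next
    case False
    then obtain z where z: "z \<in> M" "z \<in> L"
      using cap_incr_nonzero[OF P(1) Q(1) xM yL False] by metis
    then have "z \<in> ball x \<delta>" "z \<in> ball y \<delta>" using P(2) Q(2) that unfolding fine_def by blast+
    then have "\<bar>x - y\<bar> < 2 * \<delta>" by (auto simp: dist_real_def)
    then have fe: "norm (f x - f y) \<le> e"
      using osc tag_in_interval[OF P(1) that(1)] tag_in_interval[OF Q(1) that(2)] by blast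
    have "norm (B (f x - f y) (cap_incr g M L)) \<le> norm (f x - f y) * norm (cap_incr g M L) * K"
      by (rule K)
    also have "\<dots> \<le> e * cap_incr v M L * K"
      using fe cap_incr_norm_le[OF v P(1) Q(1) that] \<open>K \<ge> 0\<close>
      by (intro mult_right_mono mult_mono) (auto intro: order_trans[OF norm_ge_zero])
    finally show ?thesis by (simp add: mult_ac)
  qed
  then have "norm (RS_sum B f g P - RS_sum B f g Q) \<le> (\<Sum>(x, M)\<in>P. \<Sum>(y, L)\<in>Q. e * K * cap_incr v M L)"
    unfolding * by (force intro!: sum_norm_le simp: split_def)
  also have "\<dots> = (\<Sum>(x, M)\<in>P. e * K * (v (Sup M) - v (Inf M)))"
    by (intro sum.cong refl, clarify)
       (simp add: sum_cap_incr[OF ab Q(1) P(1), symmetric] sum_distrib_left split_def)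
  also have "\<dots> = e * K * (v b - v a)"
    using additive_tagged_division_1[OF ab P(1), of v] by (simp add: sum_distrib_left[symmetric] split_def)
  finally show ?thesis .
qed

text \<open>Uniform continuity of \<open>f\<close> makes the sums over fine divisions Cauchy. The
  limit along one sequence of divisions with radii \<open>1 / Suc n\<close> exists by completeness,
  and the same Cauchy estimate compares it with every other fine division.\<close>

lemma has_RS_integral_exists:
  fixes f :: "real \<Rightarrow> 'a::real_normed_vector" and B :: "'a \<Rightarrow> 'b::real_normed_vector \<Rightarrow> 'c::banach"
  assumes B: "bounded_bilinear B" and ab: "a \<le> b" and f: "continuous_on {a..b} f"
    and v: "dominates v g a b"
  obtains I where "has_RS_integral B f g a b I"
proof -
  obtain K where K: "K > 0" "\<And>x y. norm (B x y) \<le> norm x * norm y * K"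
    using bounded_bilinear.pos_bounded[OF B] by metis
  have V: "v b - v a \<ge> 0" using dominates_mono[OF v] ab by simp
  have cauchy: "\<exists>d>0. \<forall>P Q. P tagged_division_of {a..b} \<and> (\<lambda>x. ball x d) fine P \<and>
      Q tagged_division_of {a..b} \<and> (\<lambda>x. ball x d) fine Q \<longrightarrow>
      norm (RS_sum B f g P - RS_sum B f g Q) < e" if "e > 0" for e
  proof -
    \<comment> \<open>The summand 1 keeps the denominator positive when \<open>v\<close> is constant
      and makes the final inequality strict.\<close>
    define e' where "e' = e / (K * (v b - v a) + 1)"
    have pos: "K * (v b - v a) + 1 > 0" using K V by (simp add: add_nonneg_pos)
    then have e': "e' > 0" using that by (simp add: e'_def)
    have "uniformly_continuous_on {a..b} f" using f compact_uniformly_continuous by blast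
    then obtain d where d0: "d > 0"
      and "\<forall>x\<in>{a..b}. \<forall>y\<in>{a..b}. dist y x < d \<longrightarrow> dist (f y) (f x) < e'"
      using e' unfolding uniformly_continuous_on_def by meson
    then have d: "norm (f x - f y) \<le> e'" if "x \<in> {a..b}" "y \<in> {a..b}" "\<bar>x - y\<bar> < d" for x y
      using that by (metis dist_norm dist_real_def less_imp_le)
    have "e' * K * (v b - v a) < e"
      using pos that by (simp add: e'_def field_simps)
    \<comment> \<open>Radius \<open>d / 2\<close>, because tags of overlapping intervals may be
      twice the radius apart.\<close>
    moreover have "norm (RS_sum B f g P - RS_sum B f g Q) \<le> e' * K * (v b - v a)"
      if "P tagged_division_of {a..b}" "(\<lambda>x. ball x (d/2)) fine P"
         "Q tagged_division_of {a..b}" "(\<lambda>x. ball x (d/2)) fine Q" for P Q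
      using K(1) by (intro RS_sum_diff_le[OF B K(2) ab v that] d) auto
    ultimately have lt: "norm (RS_sum B f g P - RS_sum B f g Q) < e"
      if "P tagged_division_of {a..b}" "(\<lambda>x. ball x (d/2)) fine P"
         "Q tagged_division_of {a..b}" "(\<lambda>x. ball x (d/2)) fine Q" for P Q
      using le_less_trans that by blast
    show ?thesis
    proof (intro exI[of _ "d/2"] conjI allI impI)
      show "d / 2 > 0" using d0 by simp
    qed (elim conjE, rule lt)
  qed
  define fd where "fd n P \<longleftrightarrow> P tagged_division_of {a..b} \<and> (\<lambda>x. ball x (1 / Suc n)) fine P" for n P
  have "\<exists>P. fd n P" for n
    by (rule fine_division_exists_real[OF gauge_ball, of "1 / Suc n" a b]) (auto simp: fd_def)
  then obtain P where P: "\<And>n. fd n (P n)" by metis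
  have small: "\<exists>N. \<forall>n\<ge>N. 1 / Suc n \<le> d" if d: "d > 0" for d :: real
  proof -
    obtain N where "1 / Suc N < d" by (rule nat_approx_posE[OF d])
    then have "1 / Suc n \<le> d" if "n \<ge> N" for n
      using frac_le[of 1 1 "Suc N" "Suc n"] that by auto
    then show ?thesis by blast
  qed
  have "Cauchy (\<lambda>n. RS_sum B f g (P n))"
  proof (rule CauchyI)
    fix e :: real assume "e > 0"
    then obtain d where d: "d > 0" "\<And>P Q. P tagged_division_of {a..b} \<Longrightarrow> (\<lambda>x. ball x d) fine P \<Longrightarrow>
      Q tagged_division_of {a..b} \<Longrightarrow> (\<lambda>x. ball x d) fine Q \<Longrightarrow>
      norm (RS_sum B f g P - RS_sum B f g Q) < e" using cauchy by meson
    obtain N where "\<forall>n\<ge>N. 1 / Suc n \<le> d" using small[OF d(1)] by blast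
    then have "norm (RS_sum B f g (P m) - RS_sum B f g (P n)) < e" if "m \<ge> N" "n \<ge> N" for m n
      using P[unfolded fd_def] that by (intro d(2)) (auto intro: fine_ball_mono)
    then show "\<exists>M. \<forall>m\<ge>M. \<forall>n\<ge>M. norm (RS_sum B f g (P m) - RS_sum B f g (P n)) < e"
      by blast
  qed
  then obtain I where I: "(\<lambda>n. RS_sum B f g (P n)) \<longlonglongrightarrow> I" using Cauchy_convergent convergent_def by blast
  have "has_RS_integral B f g a b I"
    unfolding has_RS_integral_alt
  proof (intro allI impI)
    fix e :: real assume e: "e > 0"
    then obtain d where d: "d > 0" "\<And>P Q. P tagged_division_of {a..b} \<Longrightarrow> (\<lambda>x. ball x d) fine P \<Longrightarrow>
      Q tagged_division_of {a..b} \<Longrightarrow> (\<lambda>x. ball x d) fine Q \<Longrightarrow>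
      norm (RS_sum B f g P - RS_sum B f g Q) < e/2" using cauchy[of "e/2"] half_gt_zero by meson
    obtain N where N: "\<forall>n\<ge>N. 1 / Suc n \<le> d" using small[OF d(1)] by blast
    obtain M where M: "\<forall>n\<ge>M. norm (RS_sum B f g (P n) - I) < e/2"
      using LIMSEQ_D[OF I, of "e/2"] e by auto
    define n where "n = max M N"
    have "norm (RS_sum B f g Q - I) < e" if "Q tagged_division_of {a..b}" "(\<lambda>x. ball x d) fine Q" for Q
    proof -
      have "norm (RS_sum B f g Q - RS_sum B f g (P n)) < e/2"
        by (rule d(2)) (use that P[of n] N fine_ball_mono[of "1 / Suc n" "P n" d] in \<open>auto simp: fd_def n_def\<close>)
      moreover have "norm (RS_sum B f g (P n) - I) < e/2" using M by (simp add: n_def)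
      ultimately show ?thesis by norm
    qed
    then show "\<exists>\<delta>>0. \<forall>P. P tagged_division_of {a..b} \<and> (\<lambda>x. ball x \<delta>) fine P \<longrightarrow> norm (RS_sum B f g P - I) < e"
      using d(1) by blast
  qed
  then show ?thesis using that by blast
qed

lemma has_RS_integral_RS_integral:
  fixes f :: "real \<Rightarrow> 'a::real_normed_vector" and B :: "'a \<Rightarrow> 'b::real_normed_vector \<Rightarrow> 'c::banach"
  assumes "bounded_bilinear B" "a \<le> b" "continuous_on {a..b} f" "dominates v g a b"
  shows "has_RS_integral B f g a b (RS_integral B f g a b)"
  using has_RS_integral_exists[OF assms] RS_integral_eqI by metis

lemma has_RS_integral_norm_le:
  assumes K: "\<And>x y. norm (B x y) \<le> norm x * norm y * K" and K0: "K \<ge> 0" and ab: "a \<le> b"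
    and v: "dominates v g a b" and M: "\<And>x. x \<in> {a..b} \<Longrightarrow> norm (f x) \<le> M"
    and I: "has_RS_integral B f g a b I"
  shows "norm I \<le> M * K * (v b - v a)"
proof (rule field_le_epsilon)
  fix e :: real assume "e > 0"
  then obtain d where d: "d > 0" "\<And>P d'. P tagged_division_of {a..b} \<Longrightarrow> d' \<le> d \<Longrightarrow> (\<lambda>x. ball x d') fine P \<Longrightarrow>
    norm (RS_sum B f g P - I) < e" using has_RS_integral_fineE[OF I] by metis
  obtain P where P: "P tagged_division_of {a..b}" "(\<lambda>x. ball x d) fine P"
    using fine_division_exists_real[OF gauge_ball[OF d(1)]] by blast
  have "norm (RS_sum B f g P) \<le> (\<Sum>(x, L)\<in>P. M * K * (v (Sup L) - v (Inf L)))"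
    unfolding RS_sum_def
  proof (rule sum_norm_le, clarify)
    fix x L assume xL: "(x, L) \<in> P"
    note L = tagged_division_interval[OF P(1) xL]
    have x: "norm (f x) \<le> M" using M tag_in_interval[OF P(1) xL] by blast
    have "norm (B (f x) (g (Sup L) - g (Inf L))) \<le> norm (f x) * norm (g (Sup L) - g (Inf L)) * K" by (rule K)
    also have "\<dots> \<le> M * (v (Sup L) - v (Inf L)) * K"
      using x K0 L by (intro mult_right_mono mult_mono dominatesD[OF v]) (auto intro: order_trans[OF norm_ge_zero])
    finally show "norm (B (f x) (g (Sup L) - g (Inf L))) \<le> M * K * (v (Sup L) - v (Inf L))"
      by (simp add: mult_ac)
  qed
  also have "\<dots> = M * K * (v b - v a)"
    using additive_tagged_division_1[OF ab P(1), of v] by (simp add: sum_distrib_left[symmetric] split_def)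
  finally have "norm (RS_sum B f g P) \<le> M * K * (v b - v a)" .
  moreover have "norm (RS_sum B f g P - I) < e" using d(2)[OF P(1) order_refl P(2)] .
  ultimately show "norm I \<le> M * K * (v b - v a) + e"
    using norm_triangle_sub[of I "RS_sum B f g P"] by (simp add: norm_minus_commute)
qed

text \<open>A pair lying in both divisions has an interval degenerate at \<open>c\<close>, hence a
  zero summand, so nothing is lost by the set union counting it once.\<close>

lemma RS_sum_Un:
  fixes a b c :: real
  assumes B: "bounded_bilinear B"
    and P: "P tagged_division_of {a..c}" and Q: "Q tagged_division_of {c..b}"
  shows "RS_sum B f g (P \<union> Q) = RS_sum B f g P + RS_sum B f g Q"
proof -
  interpret B: bounded_bilinear B by fact
  have "RS_sum B f g (P \<inter> Q) = 0"
    unfolding RS_sum_def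
  proof (rule sum.neutral, safe)
    fix x L assume "(x, L) \<in> P" "(x, L) \<in> Q"
    then have "Inf L = Sup L"
      using tagged_division_interval[OF P] tagged_division_interval[OF Q] by fastforce
    then show "B (f x) (g (Sup L) - g (Inf L)) = 0" by (simp add: B.zero_right)
  qed
  moreover have "finite P" "finite Q" using P Q by (blast dest: tagged_division_ofD(1))+
  ultimately show ?thesis
    unfolding RS_sum_def
    using sum.union_inter[of P Q "\<lambda>(x, K). B (f x) (g (Sup K) - g (Inf K))"] by simp
qed

text \<open>With existence over \<open>{a..b}\<close> granted, it suffices to test its value
  \<open>H\<close> on divisions that break at \<open>c\<close>.\<close>

lemma has_RS_integral_combine:
  assumes B: "bounded_bilinear B" and "a \<le> c" "c \<le> b"
    and I: "has_RS_integral B f g a c I" and J: "has_RS_integral B f g c b J"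
    and H: "has_RS_integral B f g a b H"
  shows "H = I + J"
proof -
  have "norm (H - (I + J)) < e" if e: "e > 0" for e
  proof -
    have e3: "e/3 > 0" using e by simp
    obtain d1 where d1: "d1 > 0" "\<And>P d'. P tagged_division_of {a..c} \<Longrightarrow> d' \<le> d1 \<Longrightarrow> (\<lambda>x. ball x d') fine P \<Longrightarrow>
      norm (RS_sum B f g P - I) < e/3" using has_RS_integral_fineE[OF I e3] by metis
    obtain d2 where d2: "d2 > 0" "\<And>P d'. P tagged_division_of {c..b} \<Longrightarrow> d' \<le> d2 \<Longrightarrow> (\<lambda>x. ball x d') fine P \<Longrightarrow>
      norm (RS_sum B f g P - J) < e/3" using has_RS_integral_fineE[OF J e3] by metis
    obtain d3 where d3: "d3 > 0" "\<And>P d'. P tagged_division_of {a..b} \<Longrightarrow> d' \<le> d3 \<Longrightarrow> (\<lambda>x. ball x d') fine P \<Longrightarrow>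
      norm (RS_sum B f g P - H) < e/3" using has_RS_integral_fineE[OF H e3] by metis
    define d where "d = min d1 (min d2 d3)"
    have d: "d > 0" "d \<le> d1" "d \<le> d2" "d \<le> d3" using d1 d2 d3 by (auto simp: d_def)
    obtain P where P: "P tagged_division_of {a..c}" "(\<lambda>x. ball x d) fine P"
      using fine_division_exists_real[OF gauge_ball[OF d(1)]] by blast
    obtain Q where Q: "Q tagged_division_of {c..b}" "(\<lambda>x. ball x d) fine Q"
      using fine_division_exists_real[OF gauge_ball[OF d(1)]] by blast
    have "{a..b} \<inter> {x. x \<bullet> 1 \<le> c} = {a..c}" "{a..b} \<inter> {x. x \<bullet> 1 \<ge> c} = {c..b}"
      using assms(2,3) by auto
    then have "(P \<union> Q) tagged_division_of {a..b}"
      using P(1) Q(1) by (intro tagged_division_Un_interval_real[of _ _ _ 1 c]) auto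
    then have PQ: "norm (RS_sum B f g (P \<union> Q) - H) < e/3"
      using d(4) fine_Un[OF P(2) Q(2)] by (rule d3(2))
    have "H - (I + J) = (RS_sum B f g P - I) + (RS_sum B f g Q - J) - (RS_sum B f g (P \<union> Q) - H)"
      using RS_sum_Un[OF B P(1) Q(1), of f g] by simp
    then have "norm (H - (I + J)) = norm ((RS_sum B f g P - I) + (RS_sum B f g Q - J)
        - (RS_sum B f g (P \<union> Q) - H))" by (rule arg_cong)
    then have "norm (H - (I + J)) \<le> norm (RS_sum B f g P - I) + norm (RS_sum B f g Q - J)
        + norm (RS_sum B f g (P \<union> Q) - H)"
      using norm_triangle_ineq4[of "(RS_sum B f g P - I) + (RS_sum B f g Q - J)" "RS_sum B f g (P \<union> Q) - H"]
        norm_triangle_ineq[of "RS_sum B f g P - I" "RS_sum B f g Q - J"] by linarith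
    then show ?thesis
      using PQ d1(2)[OF P(1) d(2) P(2)] d2(2)[OF Q(1) d(3) Q(2)] by linarith
  qed
  then show ?thesis by (metis less_irrefl right_minus_eq zero_less_norm_iff)
qed

section \<open>Iterated integrals and Chen's relation\<close>

lemma RS_sum_add_const:
  assumes B: "bounded_bilinear B" and ab: "a \<le> b" and P: "P tagged_division_of {a..b}"
  shows "RS_sum B (\<lambda>x. f x + c) g P = RS_sum B f g P + B c (g b - g a)"
proof -
  interpret B: bounded_bilinear B by fact
  show ?thesis
    using additive_tagged_division_1[OF ab P, of g]
    by (simp add: RS_sum_def split_def B.add_left sum.distrib B.sum_right[symmetric])
qed

lemma has_RS_integral_add_const:
  assumes "bounded_bilinear B" "a \<le> b" "has_RS_integral B f g a b I"
  shows "has_RS_integral B (\<lambda>x. f x + c) g a b (I + B c (g b - g a))"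
  using assms(3) unfolding has_RS_integral_alt
  by (simp add: RS_sum_add_const[OF assms(1,2)])

text \<open>Two different paths are allowed because the cross terms in the area of a sum integrate
  one path against the other.\<close>

definition iter_int :: "('a::real_normed_vector \<Rightarrow> 'b::real_normed_vector \<Rightarrow> 'c::banach) \<Rightarrow>
    (real \<Rightarrow> 'a) \<Rightarrow> (real \<Rightarrow> 'b) \<Rightarrow> real \<Rightarrow> real \<Rightarrow> 'c" where
  "iter_int B f g s t = RS_integral B (\<lambda>u. f u - f s) g s t"

lemma has_RS_integral_iter_int:
  assumes "bounded_bilinear B" "s \<le> t" "continuous_on {s..t} f" "dominates v g s t"
  shows "has_RS_integral B (\<lambda>u. f u - f s) g s t (iter_int B f g s t)"
  unfolding iter_int_def
  by (rule has_RS_integral_RS_integral[OF assms(1,2) _ assms(4)]) (intro continuous_intros assms(3))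

text \<open>Split the outer integral at \<open>t\<close>. On \<open>{t..u}\<close> the integrand
  based at \<open>s\<close> exceeds the one based at \<open>t\<close> by the constant
  \<open>f t - f s\<close>, and integrating this constant gives the product term.\<close>

lemma iter_int_chen:
  assumes B: "bounded_bilinear B" and "s \<le> t" "t \<le> u" and f: "continuous_on {s..u} f"
    and v: "dominates v g s u"
  shows "iter_int B f g s u = iter_int B f g s t + iter_int B f g t u + B (f t - f s) (g u - g t)"
proof -
  have su: "s \<le> u" using assms by simp
  have "has_RS_integral B (\<lambda>x. (f x - f t) + (f t - f s)) g t u
      (iter_int B f g t u + B (f t - f s) (g u - g t))"
    using assms
    by (intro has_RS_integral_add_const has_RS_integral_iter_int[where v = v])
       (auto elim: continuous_on_subset dominates_subset)
  moreover have "has_RS_integral B (\<lambda>x. f x - f s) g s t (iter_int B f g s t)"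
    using assms by (intro has_RS_integral_iter_int[where v = v]) (auto elim: continuous_on_subset dominates_subset)
  ultimately show ?thesis
    using has_RS_integral_combine[OF B assms(2,3) _ _ has_RS_integral_iter_int[OF B su f v]]
    by (simp add: add.assoc)
qed

lemma iter_int_norm_le:
  assumes "bounded_bilinear B" "\<And>x y. norm (B x y) \<le> norm x * norm y * K" "K \<ge> 0"
    "s \<le> t" "continuous_on {s..t} f" "dominates v g s t" "\<And>x. x \<in> {s..t} \<Longrightarrow> norm (f x - f s) \<le> M"
  shows "norm (iter_int B f g s t) \<le> M * K * (v t - v s)"
  using has_RS_integral_norm_le[OF assms(2,3,4,6,7) has_RS_integral_iter_int[OF assms(1,4,5,6)]] .


section \<open>\<open>p\<close>-variation\<close>

text \<open>Recursive form of the indexed sum in \<open>pvar_sum\<close>, suited to inductions over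
  partitions and to chains that are extended at an end.\<close>

fun psum :: "(real \<times> real \<Rightarrow> real) \<Rightarrow> real list \<Rightarrow> real" where
  "psum h (x # y # ys) = h (x, y) + psum h (y # ys)"
| "psum h _ = 0"

lemma pvar_sum_eq_psum: "pvar_sum p \<alpha> D = psum (\<lambda>x. norm (\<alpha> x) powr p) D"
proof -
  have "(\<Sum>j<length D - 1. h (D ! j, D ! Suc j)) = psum h D" for h
    by (induction h D rule: psum.induct) (simp_all add: sum.lessThan_Suc_shift del: sum.lessThan_Suc)
  then show ?thesis by (simp add: pvar_sum_def)
qed

lemma psum_nonneg: "(\<And>x. h x \<ge> 0) \<Longrightarrow> psum h xs \<ge> 0"
  by (induction h xs rule: psum.induct) auto

lemma psum_snoc: "xs \<noteq> [] \<Longrightarrow> psum h (xs @ [y]) = psum h xs + h (last xs, y)"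
  by (induction h xs rule: psum.induct) auto

lemma psum_map_upt: "psum h (map f [0..<Suc m]) = (\<Sum>j<m. h (f j, f (Suc j)))"
proof (induction m)
  case (Suc m)
  then show ?case using psum_snoc[of "map f [0..<Suc m]" h "f (Suc m)"] by (simp add: last_map)
qed simp

text \<open>Adjoining the missing end points \<open>0\<close> and \<open>T\<close> only adds
  nonnegative terms. Hence any finite chain in the interval, not just a partition, is controlled by
  the variation.\<close>

lemma partition_extending:
  assumes h: "\<And>x. h x \<ge> 0" and xs: "sorted_wrt (<) xs" "xs \<noteq> []" "set xs \<subseteq> {0..T}"
  obtains D where "D \<in> partitions T" "psum h xs \<le> psum h D"
proof -
  define ys where "ys = (if hd xs = 0 then xs else 0 # xs)"
  have ys: "sorted_wrt (<) ys" "ys \<noteq> []" "set ys \<subseteq> {0..T}" "hd ys = 0" "psum h xs \<le> psum h ys"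
  proof -
    obtain z zs where z: "xs = z # zs" using xs(2) by (cases xs) auto
    have "0 < z" if "z \<noteq> 0" using xs(3) z that by (auto simp: less_le)
    then show "sorted_wrt (<) ys" "ys \<noteq> []" "set ys \<subseteq> {0..T}" "hd ys = 0" "psum h xs \<le> psum h ys"
      using xs h by (auto simp: ys_def z)
  qed
  define D where "D = (if last ys = T then ys else ys @ [T])"
  have le: "x \<le> last ys" if "x \<in> set ys" for x
    using ys(1,2) that by (induction ys) (auto simp: less_imp_le)
  have "last ys \<in> set ys" using ys(2) by simp
  then have "last ys \<le> T" using ys(3) by auto
  then have "x < T" if "x \<in> set ys" "last ys \<noteq> T" for x using le[OF that(1)] that(2) by linarith
  then have "sorted_wrt (<) D"
    using ys(1) unfolding D_def by (auto simp: sorted_wrt_append)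
  moreover have "psum h ys \<le> psum h D" using h ys(2) by (simp add: D_def psum_snoc)
  ultimately show ?thesis using that[of D] ys by (auto simp: partitions_def D_def)
qed

lemma pvar_le:
  assumes "p > 0" "R \<ge> 0" "\<And>D. D \<in> partitions T \<Longrightarrow> pvar_sum p \<alpha> D \<le> R"
  shows "pvar p T \<alpha> \<le> ennreal (R powr (1 / p))"
proof -
  define S where "S = (SUP D\<in>partitions T. ennreal (pvar_sum p \<alpha> D))"
  have "S \<le> ennreal R" unfolding S_def by (intro SUP_least ennreal_leI assms(3))
  then have "S \<noteq> \<infinity>" "enn2real S \<le> R"
    using assms(2) by (auto simp: top_unique enn2real_leI)
  then show ?thesis
    unfolding pvar_def S_def[symmetric] using assms by (auto intro!: ennreal_leI powr_mono2)
qed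

lemma pvar_sum_le_pvar:
  assumes "p > 0" "D \<in> partitions T"
  shows "ennreal (pvar_sum p \<alpha> D powr (1 / p)) \<le> pvar p T \<alpha>"
proof -
  define S where "S = (SUP D\<in>partitions T. ennreal (pvar_sum p \<alpha> D))"
  have "ennreal (pvar_sum p \<alpha> D) \<le> S" unfolding S_def using assms by (intro SUP_upper)
  moreover have "pvar_sum p \<alpha> D \<ge> 0" by (simp add: pvar_sum_def sum_nonneg)
  ultimately have "pvar_sum p \<alpha> D \<le> enn2real S" if "S \<noteq> \<infinity>"
    using that by (metis enn2real_ennreal enn2real_mono infinity_ennreal_def top.not_eq_extremum)
  then show ?thesis
    unfolding pvar_def S_def[symmetric] using assms \<open>pvar_sum p \<alpha> D \<ge> 0\<close>
    by (auto intro!: ennreal_leI powr_mono2)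
qed

lemma psum_le_pvar:
  assumes "p > 0" "sorted_wrt (<) xs" "xs \<noteq> []" "set xs \<subseteq> {0..T}"
  shows "ennreal (psum (\<lambda>x. norm (\<alpha> x) powr p) xs powr (1 / p)) \<le> pvar p T \<alpha>"
proof -
  let ?h = "\<lambda>x. norm (\<alpha> x) powr p"
  obtain D where D: "D \<in> partitions T" "psum ?h xs \<le> psum ?h D"
    using partition_extending[of ?h xs T] assms by auto
  have "0 \<le> psum ?h xs" by (rule psum_nonneg) simp
  then have "ennreal (psum ?h xs powr (1 / p)) \<le> ennreal (pvar_sum p \<alpha> D powr (1 / p))"
    using D(2) assms(1) by (intro ennreal_leI powr_mono2) (auto simp: pvar_sum_eq_psum)
  also have "\<dots> \<le> pvar p T \<alpha>" by (rule pvar_sum_le_pvar[OF assms(1) D(1)])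
  finally show ?thesis .
qed

lemma norm_le_pvar:
  assumes "p > 0" "0 \<le> s" "s < t" "t \<le> T"
  shows "ennreal (norm (\<alpha> (s, t))) \<le> pvar p T \<alpha>"
  using psum_le_pvar[of p "[s, t]" T \<alpha>] assms by (simp add: powr_powr)

lemma pvar_tendsto_pointwise:
  assumes "p > 0" "0 \<le> s" "s < t" "t \<le> T" and "(\<lambda>n. pvar p T (\<beta> n)) \<longlonglongrightarrow> 0"
  shows "(\<lambda>n. \<beta> n (s, t)) \<longlonglongrightarrow> 0"
proof -
  have "(\<lambda>n. ennreal (norm (\<beta> n (s, t)))) \<longlonglongrightarrow> 0"
    using norm_le_pvar[OF assms(1-4)]
    by (intro tendsto_sandwich[OF _ _ tendsto_const assms(5)] always_eventually allI) auto
  then have "(\<lambda>n. norm (\<beta> n (s, t))) \<longlonglongrightarrow> 0"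
    using tendsto_ennrealD[of "\<lambda>n. norm (\<beta> n (s, t))" 0 sequentially] by simp
  then show ?thesis by (rule tendsto_norm_zero_cancel)
qed

lemma pvar_one_sum_le:
  assumes "strict_mono_on {..m} x" "x ` {..m} \<subseteq> {0..T}" "pvar 1 T \<alpha> \<le> ennreal R" "R \<ge> 0"
  shows "(\<Sum>j<m. norm (\<alpha> (x j, x (Suc j)))) \<le> R"
proof -
  let ?xs = "map x [0..<Suc m]"
  have "sorted_wrt (<) ?xs"
    unfolding sorted_wrt_map
    by (rule sorted_wrt_mono_rel[of _ "(<)"]) (use assms(1) in \<open>auto simp: strict_mono_on_def simp del: upt_Suc\<close>)
  moreover have "set ?xs \<subseteq> {0..T}" using assms(2) by (auto simp del: upt_Suc)
  ultimately have "ennreal (psum (\<lambda>x. norm (\<alpha> x) powr 1) ?xs powr 1) \<le> pvar 1 T \<alpha>"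
    using psum_le_pvar[of 1 ?xs T \<alpha>] by simp
  then have "ennreal (\<Sum>j<m. norm (\<alpha> (x j, x (Suc j)))) \<le> ennreal R"
    using assms(3) by (simp add: psum_map_upt sum_nonneg del: upt_Suc)
  then show ?thesis using assms(4) by simp
qed

text \<open>The witness \<open>v t\<close> is the total variation on \<open>{0..t}\<close>, as a
  supremum over chains. A chain up to \<open>s\<close>, prolonged through \<open>s\<close> to
  \<open>t\<close>, shows that \<open>v t\<close> exceeds \<open>v s\<close> by at least the norm of
  the increment.\<close>

lemma C1var_dominates:
  assumes "\<gamma> \<in> C1var T"
  obtains v where "dominates v \<gamma> 0 T"
proof -
  define h where "h = (\<lambda>(s, t). norm (\<gamma> t - \<gamma> s))"
  define S where "S t = {xs. sorted_wrt (<) xs \<and> xs \<noteq> [] \<and> set xs \<subseteq> {0..t}}" for t :: real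
  define v where "v t = (SUP xs\<in>S t. psum h xs)" for t
  have fin: "pvar 1 T (increments \<gamma>) < \<infinity>" using assms by (simp add: C1var_def)
  have "psum h xs \<le> enn2real (pvar 1 T (increments \<gamma>))" if "xs \<in> S T" for xs
  proof -
    have h: "h = (\<lambda>x. norm (increments \<gamma> x) powr 1)" by (auto simp: h_def increments_def)
    have "0 \<le> psum h xs" by (rule psum_nonneg) (auto simp: h_def)
    then have "ennreal (psum h xs) \<le> pvar 1 T (increments \<gamma>)"
      using psum_le_pvar[of 1 xs T "increments \<gamma>"] that unfolding h by (simp add: S_def)
    then show ?thesis using fin \<open>0 \<le> psum h xs\<close>
      by (metis enn2real_ennreal enn2real_mono infinity_ennreal_def)
  qed
  then have "bdd_above (psum h ` S T)" by (auto simp: bdd_above_def)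
  moreover have "S t \<subseteq> S T" if "t \<le> T" for t using that by (auto simp: S_def)
  ultimately have bdd: "bdd_above (psum h ` S t)" if "t \<le> T" for t
    using that by (meson bdd_above_mono image_mono)
  have "norm (\<gamma> t - \<gamma> s) \<le> v t - v s" if st: "0 \<le> s" "s < t" "t \<le> T" for s t
  proof -
    have "psum h xs \<le> v t - h (s, t)" if xs: "xs \<in> S s" for xs
    proof -
      have x: "sorted_wrt (<) xs" "xs \<noteq> []" "set xs \<subseteq> {0..s}" using xs by (auto simp: S_def)
      have le: "x \<le> last xs" if "x \<in> set xs" for x
        using x(1,2) that by (induction xs) (auto simp: less_imp_le)
      have ls: "last xs \<le> s" using x(2,3) last_in_set by fastforce
      \<comment> \<open>Chains increase strictly, so \<open>s\<close> may be inserted only when it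
        is not already the last point.\<close>
      show ?thesis
      proof (cases "last xs = s")
        case True
        have "xs @ [t] \<in> S t" using x st by (force simp: S_def sorted_wrt_append)
        then have "psum h (xs @ [t]) \<le> v t" unfolding v_def using bdd[OF st(3)] by (rule cSUP_upper)
        then show ?thesis using True x(2) by (simp add: psum_snoc)
      next
        case False
        then have "x < s" if "x \<in> set xs" for x using le[OF that] ls by linarith
        then have "xs @ [s, t] \<in> S t" using x st by (force simp: S_def sorted_wrt_append)
        then have "psum h (xs @ [s, t]) \<le> v t" unfolding v_def using bdd[OF st(3)] by (rule cSUP_upper)
        moreover have "psum h (xs @ [s, t]) = psum h xs + h (last xs, s) + h (s, t)"
          using psum_snoc[of "xs @ [s]" h t] x(2) by (simp add: psum_snoc)
        moreover have "h (last xs, s) \<ge> 0" by (simp add: h_def)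
        ultimately show ?thesis by simp
      qed
    qed
    moreover have "[0] \<in> S s" using st by (simp add: S_def)
    ultimately have "v s \<le> v t - h (s, t)" unfolding v_def[of s] by (intro cSUP_least) auto
    then show ?thesis by (simp add: h_def)
  qed
  then have "dominates v \<gamma> 0 T" unfolding dominates_def by (metis diff_self le_less norm_zero)
  then show ?thesis using that by blast
qed

section \<open>Tensors and the area\<close>

lemma alg_tensor_of_add_left: "(a + a') \<otimes>\<^sub>a b = a \<otimes>\<^sub>a b + a' \<otimes>\<^sub>a b"
proof (transfer, unfold tensor_equiv_def)
  fix a a' :: 'a and b :: 'b
  have "Poly_Mapping.single (a + a', b) 1 - Poly_Mapping.single (a, b) 1
        - Poly_Mapping.single (a', b) 1 \<in> (tensor_relations :: ('a \<times> 'b, real) poly_mapping set)"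
    unfolding tensor_relations_def by blast
  then show "Poly_Mapping.single (a + a', b) 1
      - (Poly_Mapping.single (a, b) 1 + Poly_Mapping.single (a', b) 1)
      \<in> span (tensor_relations :: ('a \<times> 'b, real) poly_mapping set)"
    by (simp add: span_base diff_diff_eq)
qed

lemma alg_tensor_of_add_right: "a \<otimes>\<^sub>a (b + b') = a \<otimes>\<^sub>a b + a \<otimes>\<^sub>a b'"
proof (transfer, unfold tensor_equiv_def)
  fix a :: 'a and b b' :: 'b
  have "Poly_Mapping.single (a, b + b') 1 - Poly_Mapping.single (a, b) 1
        - Poly_Mapping.single (a, b') 1 \<in> (tensor_relations :: ('a \<times> 'b, real) poly_mapping set)"
    unfolding tensor_relations_def by blast
  then show "Poly_Mapping.single (a, b + b') 1
      - (Poly_Mapping.single (a, b) 1 + Poly_Mapping.single (a, b') 1)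
      \<in> span (tensor_relations :: ('a \<times> 'b, real) poly_mapping set)"
    by (simp add: span_base diff_diff_eq)
qed

lemma alg_tensor_of_scaleR_left: "(r *\<^sub>R a) \<otimes>\<^sub>a b = r *\<^sub>R (a \<otimes>\<^sub>a b)"
proof (transfer, unfold tensor_equiv_def)
  fix r and a :: 'a and b :: 'b
  have "Poly_Mapping.single (r *\<^sub>R a, b) 1 - r *\<^sub>R Poly_Mapping.single (a, b) 1
        \<in> (tensor_relations :: ('a \<times> 'b, real) poly_mapping set)"
    unfolding tensor_relations_def by blast
  then show "Poly_Mapping.single (r *\<^sub>R a, b) 1 - r *\<^sub>R Poly_Mapping.single (a, b) 1
        \<in> span (tensor_relations :: ('a \<times> 'b, real) poly_mapping set)"
    by (rule span_base)
qed

lemma alg_tensor_of_scaleR_right: "a \<otimes>\<^sub>a (r *\<^sub>R b) = r *\<^sub>R (a \<otimes>\<^sub>a b)"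
proof (transfer, unfold tensor_equiv_def)
  fix r and a :: 'a and b :: 'b
  have "Poly_Mapping.single (a, r *\<^sub>R b) 1 - r *\<^sub>R Poly_Mapping.single (a, b) 1
        \<in> (tensor_relations :: ('a \<times> 'b, real) poly_mapping set)"
    unfolding tensor_relations_def by blast
  then show "Poly_Mapping.single (a, r *\<^sub>R b) 1 - r *\<^sub>R Poly_Mapping.single (a, b) 1
        \<in> span (tensor_relations :: ('a \<times> 'b, real) poly_mapping set)"
    by (rule span_base)
qed

lemma norm_tbracket_le:
  assumes "tensor_completion \<iota>"
  shows "norm (tbracket \<iota> a b) \<le> norm a * norm b * 2"
proof -
  have "norm (\<iota> (a \<otimes>\<^sub>a b)) \<le> norm a * norm b" "norm (\<iota> (b \<otimes>\<^sub>a a)) \<le> norm a * norm b"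
    using assms unfolding tensor_completion_def by (blast, metis mult.commute)
  then show ?thesis
    using norm_triangle_ineq4[of "\<iota> (a \<otimes>\<^sub>a b)" "\<iota> (b \<otimes>\<^sub>a a)"] by (simp add: tbracket_def)
qed

lemma bounded_bilinear_tbracket:
  assumes "tensor_completion \<iota>"
  shows "bounded_bilinear (tbracket \<iota>)"
proof
  have lin: "linear \<iota>" using assms by (simp add: tensor_completion_def)
  show "tbracket \<iota> (a + a') b = tbracket \<iota> a b + tbracket \<iota> a' b" for a a' b
    by (simp add: tbracket_def alg_tensor_of_add_left alg_tensor_of_add_right linear_add[OF lin])
  show "tbracket \<iota> a (b + b') = tbracket \<iota> a b + tbracket \<iota> a b'" for a b b'
    by (simp add: tbracket_def alg_tensor_of_add_left alg_tensor_of_add_right linear_add[OF lin])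
  show "tbracket \<iota> (r *\<^sub>R a) b = r *\<^sub>R tbracket \<iota> a b" for r a b
    by (simp add: tbracket_def alg_tensor_of_scaleR_left alg_tensor_of_scaleR_right
        linear_scale[OF lin] scaleR_diff_right)
  show "tbracket \<iota> a (r *\<^sub>R b) = r *\<^sub>R tbracket \<iota> a b" for r a b
    by (simp add: tbracket_def alg_tensor_of_scaleR_left alg_tensor_of_scaleR_right
        linear_scale[OF lin] scaleR_diff_right)
  show "\<exists>K. \<forall>a b. norm (tbracket \<iota> a b) \<le> norm a * norm b * K"
    using norm_tbracket_le[OF assms] by blast
qed

lemma tbracket_swap: "tbracket \<iota> b a = - tbracket \<iota> a b"
  by (simp add: tbracket_def)

lemma area_eq_iter_int: "area \<iota> \<gamma> (s, t) = (1 / 2) *\<^sub>R iter_int (tbracket \<iota>) \<gamma> \<gamma> s t"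
  unfolding area_def iter_int_def
  by (auto intro!: RS_integral_cong RS_integral_const_one)

lemma area_chen:
  assumes "tensor_completion \<iota>" "s \<le> t" "t \<le> u" "continuous_on {s..u} \<gamma>" "dominates v \<gamma> s u"
  shows "area \<iota> \<gamma> (s, u) = area \<iota> \<gamma> (s, t) + area \<iota> \<gamma> (t, u)
      + (1 / 2) *\<^sub>R tbracket \<iota> (\<gamma> t - \<gamma> s) (\<gamma> u - \<gamma> t)"
  unfolding area_eq_iter_int iter_int_chen[OF bounded_bilinear_tbracket[OF assms(1)] assms(2-5)]
  by (simp add: scaleR_add_right)

text \<open>The factor 2 in the bound for the bracket cancels the factor 1/2 in
  \<open>area\<close>.\<close>

lemma norm_area_le:
  assumes "tensor_completion \<iota>" "s \<le> t" "continuous_on {s..t} \<gamma>" "dominates v \<gamma> s t"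
    "\<And>x. x \<in> {s..t} \<Longrightarrow> norm (\<gamma> x - \<gamma> s) \<le> M"
  shows "norm (area \<iota> \<gamma> (s, t)) \<le> M * (v t - v s)"
  using iter_int_norm_le[OF bounded_bilinear_tbracket[OF assms(1)] norm_tbracket_le[OF assms(1)] _ assms(2-5)]
  by (simp add: area_eq_iter_int)

lemma area_diag:
  assumes "tensor_completion \<iota>"
  shows "area \<iota> \<gamma> (t, t) = 0"
proof -
  have "dominates (\<lambda>_. 0) \<gamma> t t" unfolding dominates_def by (metis diff_self norm_zero order_antisym order_refl order_trans)
  then show ?thesis using norm_area_le[OF assms, of t t \<gamma> "\<lambda>_. 0" 0] by simp
qed

section \<open>Closability in 1-variation\<close>

definition unif_part :: "real \<Rightarrow> real \<Rightarrow> nat \<Rightarrow> nat \<Rightarrow> real" where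
  "unif_part s t m j = s + (t - s) * (j / m)"

lemma unif_part_strict_mono: "s < t \<Longrightarrow> m > 0 \<Longrightarrow> strict_mono (unif_part s t m)"
  by (auto simp: strict_mono_def unif_part_def divide_strict_right_mono)

lemma unif_part_0 [simp]: "unif_part s t m 0 = s"
  by (simp add: unif_part_def)

lemma unif_part_last: "m > 0 \<Longrightarrow> unif_part s t m m = t"
  by (simp add: unif_part_def)

lemma unif_part_mem: "s < t \<Longrightarrow> m > 0 \<Longrightarrow> j \<le> m \<Longrightarrow> unif_part s t m j \<in> {s..t}"
  using strict_mono_less_eq[OF unif_part_strict_mono[of s t m], of 0 j]
    strict_mono_less_eq[OF unif_part_strict_mono[of s t m], of j m]
  by (simp add: unif_part_last)

lemma unif_part_step: "m > 0 \<Longrightarrow> unif_part s t m (Suc j) - unif_part s t m j = (t - s) / m"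
  by (simp add: unif_part_def field_simps)

text \<open>The induction moves the right end point, which is why additivity is stated with left end
  \<open>s\<close> only. It serves both vanishing arguments: for the difference of the two limit
  areas, and for the uniqueness of the area of a Lipschitz path.\<close>

lemma unif_part_additive:
  fixes F :: "real \<times> real \<Rightarrow> 'a::ab_group_add"
  assumes "s < t" "m > 0" "F (s, s) = 0"
    and add: "\<And>x y. s \<le> x \<Longrightarrow> x \<le> y \<Longrightarrow> y \<le> t \<Longrightarrow> F (s, y) = F (s, x) + F (x, y)"
  shows "F (s, t) = (\<Sum>j<m. F (unif_part s t m j, unif_part s t m (Suc j)))"
proof -
  have "k \<le> m \<Longrightarrow> F (s, unif_part s t m k) = (\<Sum>j<k. F (unif_part s t m j, unif_part s t m (Suc j)))" for k
  proof (induction k)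
    case (Suc k)
    have "unif_part s t m k \<le> unif_part s t m (Suc k)"
      using unif_part_strict_mono[OF assms(1,2)] by (simp add: strict_mono_less_eq)
    then have "F (s, unif_part s t m (Suc k))
        = F (s, unif_part s t m k) + F (unif_part s t m k, unif_part s t m (Suc k))"
      using unif_part_mem[OF assms(1,2), of k] unif_part_mem[OF assms(1,2), of "Suc k"] Suc.prems
      by (intro add) simp_all
    then show ?case using Suc by simp
  qed (simp add: assms)
  from this[of m] show ?thesis by (simp add: unif_part_last assms)
qed

text \<open>By uniform continuity the inner increments on a fine mesh are at most \<open>e'\<close>,
  so each area is at most \<open>e'\<close> times an increment of \<open>v\<close>, and these
  increments telescope. The threshold \<open>M\<close> depends on the path.\<close>

lemma area_sum_small:
  assumes \<iota>: "tensor_completion \<iota>" and \<gamma>: "\<gamma> \<in> C1var T" and st: "0 \<le> s" "s < t" "t \<le> T" and "e > 0"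
  obtains M where "\<And>m. m \<ge> M \<Longrightarrow>
    (\<Sum>j<m. norm (area \<iota> \<gamma> (unif_part s t m j, unif_part s t m (Suc j)))) \<le> e"
proof -
  obtain v where v: "dominates v \<gamma> 0 T" using C1var_dominates[OF \<gamma>] .
  have cont: "continuous_on {0..T} \<gamma>" using \<gamma> by (simp add: C1var_def)
  define e' where "e' = e / (v t - v s + 1)"
  have V: "v t - v s \<ge> 0" using dominates_mono[OF v] st by simp
  then have e': "e' > 0" using \<open>e > 0\<close> by (simp add: e'_def)
  have le: "e' * (v t - v s) \<le> e" using V \<open>e > 0\<close> by (simp add: e'_def field_simps)
  have "uniformly_continuous_on {0..T} \<gamma>" using cont compact_uniformly_continuous by blast
  then obtain d where d0: "d > 0"
    and "\<forall>x\<in>{0..T}. \<forall>y\<in>{0..T}. dist y x < d \<longrightarrow> dist (\<gamma> y) (\<gamma> x) < e'"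
    using e' unfolding uniformly_continuous_on_def by meson
  then have d: "norm (\<gamma> x - \<gamma> y) \<le> e'" if "x \<in> {0..T}" "y \<in> {0..T}" "\<bar>x - y\<bar> < d" for x y
    using that by (metis dist_norm dist_real_def less_imp_le)
  obtain M0 where M0: "(t - s) / d < real M0" using reals_Archimedean2 by blast
  show ?thesis
  proof (rule that[of "Suc M0"])
    fix m assume "m \<ge> Suc M0"
    then have m: "m > 0" and "(t - s) / d < m" using M0 by auto
    then have mesh: "(t - s) / m < d" using d0 by (simp add: field_simps)
    let ?x = "unif_part s t m"
    have "norm (area \<iota> \<gamma> (?x j, ?x (Suc j))) \<le> e' * (v (?x (Suc j)) - v (?x j))" if "j < m" for j
    proof (rule norm_area_le[OF \<iota>])
      have mem: "?x j \<in> {s..t}" "?x (Suc j) \<in> {s..t}" using unif_part_mem[OF st(2) m] that by auto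
      show "?x j \<le> ?x (Suc j)" using unif_part_strict_mono[OF st(2) m] by (simp add: strict_mono_less_eq)
      show "continuous_on {?x j..?x (Suc j)} \<gamma>" using cont mem st by (auto elim: continuous_on_subset)
      show "dominates v \<gamma> (?x j) (?x (Suc j))" using v mem st by (auto elim: dominates_subset)
      show "norm (\<gamma> x - \<gamma> (?x j)) \<le> e'" if "x \<in> {?x j..?x (Suc j)}" for x
        using mem st mesh unif_part_step[OF m, of s t j] that by (intro d) auto
    qed
    then have "(\<Sum>j<m. norm (area \<iota> \<gamma> (?x j, ?x (Suc j)))) \<le> (\<Sum>j<m. e' * (v (?x (Suc j)) - v (?x j)))"
      by (intro sum_mono) auto
    also have "\<dots> = e' * (v t - v s)"
      using sum_lessThan_telescope[of "\<lambda>j. v (?x j)" m]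
      by (simp add: sum_distrib_left[symmetric] unif_part_last[OF m])
    finally show "(\<Sum>j<m. norm (area \<iota> \<gamma> (?x j, ?x (Suc j)))) \<le> e" using le by linarith
  qed
qed

text \<open>Variation does not see additive constants, so only increments converge, not values.
  Chen's relation involves nothing but increments.\<close>

lemma path_conv_increments:
  assumes "path_conv_pvar p T \<gamma>s \<gamma>" "p > 0" "0 \<le> s" "s \<le> t" "t \<le> T"
  shows "(\<lambda>n. \<gamma>s n t - \<gamma>s n s) \<longlonglongrightarrow> \<gamma> t - \<gamma> s"
proof (cases "s = t")
  case False
  have "(\<lambda>n. pvar p T (increments (\<lambda>t. \<gamma>s n t - \<gamma> t))) \<longlonglongrightarrow> 0"
    using assms(1) by (simp add: path_conv_pvar_def)
  then have "(\<lambda>n. increments (\<lambda>t. \<gamma>s n t - \<gamma> t) (s, t)) \<longlonglongrightarrow> 0"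
    using pvar_tendsto_pointwise[OF assms(2,3) _ assms(5)] False assms(4) by simp
  then have "(\<lambda>n. (\<gamma>s n t - \<gamma>s n s) - (\<gamma> t - \<gamma> s)) \<longlonglongrightarrow> 0"
    by (simp add: increments_def algebra_simps)
  then show ?thesis by (rule LIM_zero_cancel)
qed simp

text \<open>Both modes of convergence imply pointwise convergence, and the bracket is continuous, so
  Chen's relation can be taken to the limit term by term.\<close>

lemma area_limit_chen:
  assumes \<iota>: "tensor_completion \<iota>" and \<gamma>s: "\<And>n. \<gamma>s n \<in> C1var T"
    and \<gamma>: "path_conv_pvar q T \<gamma>s \<gamma>" "q > 0"
    and \<alpha>: "conv_pvar p T E (\<lambda>n. area \<iota> (\<gamma>s n)) \<alpha>" "p > 0"
    and st: "0 \<le> s" "s \<le> t" "t \<le> u" "u \<le> T"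
  shows "\<alpha> (s, u) = \<alpha> (s, t) + \<alpha> (t, u) + (1 / 2) *\<^sub>R tbracket \<iota> (\<gamma> t - \<gamma> s) (\<gamma> u - \<gamma> t)"
proof -
  interpret B: bounded_bilinear "tbracket \<iota>" by (rule bounded_bilinear_tbracket[OF \<iota>])
  have lim: "(\<lambda>n. area \<iota> (\<gamma>s n) (x, y)) \<longlonglongrightarrow> \<alpha> (x, y)" if "0 \<le> x" "x \<le> y" "y \<le> T" for x y
  proof (cases "x = y")
    \<comment> \<open>Partitions increase strictly, so the variation gives no control on the
      diagonal; there both the areas and the limit are zero.\<close>
    case True
    then show ?thesis using \<alpha>(1) that by (simp add: area_diag[OF \<iota>] conv_pvar_def)
  next
    case False
    then have "(\<lambda>n. area \<iota> (\<gamma>s n) (x, y) - \<alpha> (x, y)) \<longlonglongrightarrow> 0"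
      using pvar_tendsto_pointwise[OF \<alpha>(2), of x y T "\<lambda>n z. area \<iota> (\<gamma>s n) z - \<alpha> z"] \<alpha>(1) that
      by (simp add: conv_pvar_def)
    then show ?thesis by (rule LIM_zero_cancel)
  qed
  have chen: "area \<iota> (\<gamma>s n) (s, u) = area \<iota> (\<gamma>s n) (s, t) + area \<iota> (\<gamma>s n) (t, u)
      + (1 / 2) *\<^sub>R tbracket \<iota> (\<gamma>s n t - \<gamma>s n s) (\<gamma>s n u - \<gamma>s n t)" for n
  proof -
    obtain v where "dominates v (\<gamma>s n) 0 T" using C1var_dominates[OF \<gamma>s] .
    then have "dominates v (\<gamma>s n) s u" using dominates_subset st by blast
    moreover have "continuous_on {s..u} (\<gamma>s n)"
      by (rule continuous_on_subset[of "{0..T}"]) (use \<gamma>s[of n] st in \<open>auto simp: C1var_def\<close>)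
    ultimately show ?thesis using area_chen[OF \<iota> st(2,3)] by blast
  qed
  have "(\<lambda>n. area \<iota> (\<gamma>s n) (s, u)) \<longlonglongrightarrow>
      \<alpha> (s, t) + \<alpha> (t, u) + (1 / 2) *\<^sub>R tbracket \<iota> (\<gamma> t - \<gamma> s) (\<gamma> u - \<gamma> t)"
    unfolding chen
    by (intro tendsto_intros B.tendsto lim path_conv_increments[OF \<gamma>]) (use st in auto)
  then show ?thesis using LIMSEQ_unique lim[of s u] st by force
qed

text \<open>The bracket term in the limiting Chen relation depends only on the common limit
  \<open>\<gamma>\<close>, so it cancels in \<open>\<alpha> - \<alpha>'\<close>.\<close>

lemma area_closable_one_variation:
  assumes \<iota>: "tensor_completion \<iota>"
    and \<gamma>s: "\<And>n. \<gamma>s n \<in> C1var T" "\<And>n. \<gamma>s' n \<in> C1var T"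
    and \<gamma>: "path_conv_pvar q T \<gamma>s \<gamma>" "path_conv_pvar q T \<gamma>s' \<gamma>" "q > 0"
    and \<alpha>: "conv_pvar 1 T E (\<lambda>n. area \<iota> (\<gamma>s n)) \<alpha>" "conv_pvar 1 T E (\<lambda>n. area \<iota> (\<gamma>s' n)) \<alpha>'"
    and st: "0 \<le> s" "s \<le> t" "t \<le> T"
  shows "\<alpha> (s, t) = \<alpha>' (s, t)"
proof (cases "s = t")
  case True
  then show ?thesis using \<alpha> st by (simp add: conv_pvar_def)
next
  case False
  then have lt: "s < t" using st by simp
  define D where "D x = \<alpha> x - \<alpha>' x" for x
  have diag: "D (s, s) = 0" using \<alpha> st by (simp add: D_def conv_pvar_def)
  have add: "D (s, y) = D (s, x) + D (x, y)" if "s \<le> x" "x \<le> y" "y \<le> t" for x y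
  proof -
    have y: "y \<le> T" using that st by simp
    show ?thesis unfolding D_def
      using area_limit_chen[OF \<iota> \<gamma>s(1) \<gamma>(1,3) \<alpha>(1) _ st(1) that(1,2) y]
        area_limit_chen[OF \<iota> \<gamma>s(2) \<gamma>(2,3) \<alpha>(2) _ st(1) that(1,2) y] by simp
  qed
  have "norm (D (s, t)) \<le> 0 + e" if "e > 0" for e :: real
  proof -
    \<comment> \<open>Four sums share \<open>e\<close>: two distances to the limits, which
      1-variation bounds along every partition, and two area sums, small only along fine ones. The
      indices \<open>n\<close> and \<open>n'\<close> are fixed first, since the required mesh
      depends on the chosen paths; the mesh can then be refined without spoiling the two
      distances.\<close>
    have e4: "e / 4 > 0" using that by simp
    have "\<exists>n. pvar 1 T (\<lambda>x. area \<iota> (\<gamma> n) x - \<alpha> x) < ennreal (e / 4)"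
      if "conv_pvar 1 T E (\<lambda>n. area \<iota> (\<gamma> n)) \<alpha>" for \<gamma> and \<alpha> :: "real \<times> real \<Rightarrow> 'b"
    proof -
      have "(\<lambda>n. pvar 1 T (\<lambda>x. area \<iota> (\<gamma> n) x - \<alpha> x)) \<longlonglongrightarrow> 0" using that by (simp add: conv_pvar_def)
      then have "\<forall>\<^sub>F n in sequentially. pvar 1 T (\<lambda>x. area \<iota> (\<gamma> n) x - \<alpha> x) < ennreal (e / 4)"
        using e4 by (intro order_tendstoD(2)) auto
      then show ?thesis by (rule eventually_happens'[OF sequentially_bot])
    qed
    then obtain n n' where n: "pvar 1 T (\<lambda>x. area \<iota> (\<gamma>s n) x - \<alpha> x) < ennreal (e / 4)"
        "pvar 1 T (\<lambda>x. area \<iota> (\<gamma>s' n') x - \<alpha>' x) < ennreal (e / 4)"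
      using \<alpha> by meson
    obtain M where M: "\<And>m. m \<ge> M \<Longrightarrow>
        (\<Sum>j<m. norm (area \<iota> (\<gamma>s n) (unif_part s t m j, unif_part s t m (Suc j)))) \<le> e / 4"
      using area_sum_small[OF \<iota> \<gamma>s(1) st(1) lt st(3) e4] by metis
    obtain M' where M': "\<And>m. m \<ge> M' \<Longrightarrow>
        (\<Sum>j<m. norm (area \<iota> (\<gamma>s' n') (unif_part s t m j, unif_part s t m (Suc j)))) \<le> e / 4"
      using area_sum_small[OF \<iota> \<gamma>s(2) st(1) lt st(3) e4] by metis
    define m where "m = Suc (max M M')"
    have m: "m > 0" "m \<ge> M" "m \<ge> M'" by (auto simp: m_def)
    define x where "x = unif_part s t m"
    have x: "strict_mono_on {..m} x" "x ` {..m} \<subseteq> {0..T}"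
      using unif_part_strict_mono[OF lt m(1)] unif_part_mem[OF lt m(1)] st
      by (auto simp: x_def strict_mono_def strict_mono_on_def) (force)+
    have le: "(\<Sum>j<m. norm (area \<iota> (\<gamma>s n) (x j, x (Suc j)) - \<alpha> (x j, x (Suc j)))) \<le> e / 4"
        "(\<Sum>j<m. norm (area \<iota> (\<gamma>s' n') (x j, x (Suc j)) - \<alpha>' (x j, x (Suc j)))) \<le> e / 4"
      using pvar_one_sum_le[OF x less_imp_le[OF n(1)]] pvar_one_sum_le[OF x less_imp_le[OF n(2)]] e4
      by simp_all
    have "D (s, t) = (\<Sum>j<m. D (x j, x (Suc j)))"
      unfolding x_def by (rule unif_part_additive[where F = D and s = s and t = t and m = m, OF lt m(1) diag add])
    then have "norm (D (s, t)) \<le> (\<Sum>j<m. norm (D (x j, x (Suc j))))"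
      by (simp add: norm_sum)
    also have "\<dots> \<le> (\<Sum>j<m. norm (area \<iota> (\<gamma>s n) (x j, x (Suc j)) - \<alpha> (x j, x (Suc j)))
        + norm (area \<iota> (\<gamma>s' n') (x j, x (Suc j)) - \<alpha>' (x j, x (Suc j)))
        + norm (area \<iota> (\<gamma>s n) (x j, x (Suc j))) + norm (area \<iota> (\<gamma>s' n') (x j, x (Suc j))))"
    proof (rule sum_mono)
      have "norm (a - b) \<le> norm (c - a) + norm (d - b) + norm c + norm d" for a b c d :: 'b
        by norm
      then show "norm (D (x j, x (Suc j))) \<le> norm (area \<iota> (\<gamma>s n) (x j, x (Suc j)) - \<alpha> (x j, x (Suc j)))
        + norm (area \<iota> (\<gamma>s' n') (x j, x (Suc j)) - \<alpha>' (x j, x (Suc j)))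
        + norm (area \<iota> (\<gamma>s n) (x j, x (Suc j))) + norm (area \<iota> (\<gamma>s' n') (x j, x (Suc j)))" for j
        unfolding D_def .
    qed
    also have "\<dots> \<le> e"
      using le M[OF m(2), folded x_def] M'[OF m(3), folded x_def] unfolding sum.distrib by linarith
    finally show ?thesis by simp
  qed
  then have "norm (D (s, t)) \<le> 0" by (rule field_le_epsilon)
  then show ?thesis by (simp add: D_def)
qed

section \<open>Nonzero brackets\<close>

text \<open>A single spanning vector would make \<open>vdim\<close> finite and at most 1. Hence
  neither \<open>span {0}\<close> nor \<open>span {a}\<close> is everything, which yields
  \<open>a\<close> and then \<open>b\<close>.\<close>

lemma exists_independent_pair:
  assumes "2 \<le> vdim TYPE('v::real_vector)"
  obtains a b :: "'v::real_vector" where "a \<noteq> b" "independent {a, b}"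
proof -
  have span: "span {a} \<noteq> UNIV" for a :: 'v
  proof
    assume a: "span {a} = UNIV"
    then have "dim (UNIV :: 'v set) \<le> 1" using dim_le_card[of UNIV "{a}"] by simp
    moreover have "\<exists>B::'v set. finite B \<and> span B = UNIV" using a by blast
    ultimately show False using assms by (simp add: vdim_def numeral_eq_enat)
  qed
  obtain a :: 'v where a: "a \<notin> span {0}" using span[of 0] by blast
  obtain b :: 'v where b: "b \<notin> span {a}" using span[of a] by blast
  have "a \<noteq> 0" using a span_zero by metis
  then have "independent {a}" by simp
  with b have "independent {b, a}" by (simp add: independent_insertI)
  moreover have "b \<noteq> a" using b span_base by blast
  ultimately show ?thesis using that by metis
qed

lemma lookup_scaleR: "Poly_Mapping.lookup (r *\<^sub>R x) k = r *\<^sub>R Poly_Mapping.lookup x k"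
proof -
  have "finite {i. r *\<^sub>R Poly_Mapping.lookup x i \<noteq> 0}"
    by (rule finite_subset[OF _ finite_keys[of x]]) (auto simp: in_keys_iff)
  then show ?thesis by (simp add: scaleR_poly_mapping_def Abs_poly_mapping_inverse)
qed

text \<open>The linear extension of \<open>h\<close> from the basis of pure keys to the free vector
  space.\<close>

definition pm_eval :: "('k \<Rightarrow> real) \<Rightarrow> ('k, real) poly_mapping \<Rightarrow> real" where
  "pm_eval h x = (\<Sum>k\<in>Poly_Mapping.keys x. Poly_Mapping.lookup x k * h k)"

lemma pm_eval_superset:
  assumes "finite A" "Poly_Mapping.keys x \<subseteq> A"
  shows "pm_eval h x = (\<Sum>k\<in>A. Poly_Mapping.lookup x k * h k)"
  unfolding pm_eval_def using assms by (intro sum.mono_neutral_left) (auto simp: in_keys_iff)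

lemma linear_pm_eval: "linear (pm_eval h)"
proof
  fix x y :: "('a, real) poly_mapping" and r :: real
  let ?A = "Poly_Mapping.keys x \<union> Poly_Mapping.keys y"
  show "pm_eval h (x + y) = pm_eval h x + pm_eval h y"
    using pm_eval_superset[of ?A x h] pm_eval_superset[of ?A y h]
      pm_eval_superset[of ?A "x + y" h] Poly_Mapping.keys_add[of x y]
    by (simp add: lookup_add distrib_right sum.distrib)
  have "Poly_Mapping.keys (r *\<^sub>R x) \<subseteq> Poly_Mapping.keys x" by (auto simp: in_keys_iff lookup_scaleR)
  then show "pm_eval h (r *\<^sub>R x) = r *\<^sub>R pm_eval h x"
    using pm_eval_superset[of "Poly_Mapping.keys x" "r *\<^sub>R x" h]
    by (simp add: pm_eval_def lookup_scaleR sum_distrib_left mult.assoc)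
qed

lemma pm_eval_single [simp]: "pm_eval h (Poly_Mapping.single k c) = c * h k"
  using pm_eval_superset[of "{k}" "Poly_Mapping.single k c" h] by simp

text \<open>The functional induced on the tensor product by \<open>\<phi> \<otimes> \<psi>\<close>, for a dual pair \<open>\<phi>, \<psi>\<close>,
  separates \<open>a \<otimes> b\<close> from \<open>b \<otimes> a\<close>.\<close>

lemma alg_tensor_of_swap_neq:
  fixes a b :: "'v::real_vector"
  assumes "a \<noteq> b" "independent {a, b}"
  shows "a \<otimes>\<^sub>a b \<noteq> b \<otimes>\<^sub>a a"
proof -
  obtain \<phi> :: "'v \<Rightarrow> real" where \<phi>: "linear \<phi>" "\<phi> a = 1" "\<phi> b = 0"
    using linear_independent_extend[OF assms(2), of "\<lambda>x. if x = a then 1 else 0"] assms(1) by auto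
  obtain \<psi> :: "'v \<Rightarrow> real" where \<psi>: "linear \<psi>" "\<psi> a = 0" "\<psi> b = 1"
    using linear_independent_extend[OF assms(2), of "\<lambda>x. if x = b then 1 else 0"] assms(1) by auto
  define L where "L = pm_eval (\<lambda>(x, y). \<phi> x * \<psi> y)"
  have L: "linear L" unfolding L_def by (rule linear_pm_eval)
  have single: "L (Poly_Mapping.single (x, y) c) = c * (\<phi> x * \<psi> y)" for x y c by (simp add: L_def)
  have "L x = 0" if "x \<in> tensor_relations" for x
    using that unfolding tensor_relations_def
    by (elim UnE CollectE exE conjE)
       (simp_all add: linear_diff[OF L] linear_scale[OF L] single linear_add[OF \<phi>(1)]
        linear_add[OF \<psi>(1)] linear_scale[OF \<phi>(1)] linear_scale[OF \<psi>(1)] ring_distribs)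
  then have zero: "L x = 0" if "x \<in> span tensor_relations" for x
    using linear_eq_0_on_span[OF L _ that] by blast
  have "L (Poly_Mapping.single (a, b) 1 - Poly_Mapping.single (b, a) 1) = 1"
    unfolding linear_diff[OF L] single by (simp add: \<phi> \<psi>)
  then have "\<not> tensor_equiv (Poly_Mapping.single (a, b) 1) (Poly_Mapping.single (b, a) 1)"
    unfolding tensor_equiv_def using zero by fastforce
  then show ?thesis by transfer
qed

text \<open>Injectivity of \<open>\<iota>\<close> carries the algebraic separation into the
  completion.\<close>

lemma tbracket_nonzero:
  assumes "tensor_completion \<iota>" "a \<noteq> b" "independent {a, b}"
  shows "tbracket \<iota> a b \<noteq> 0"
  using alg_tensor_of_swap_neq[OF assms(2,3)] assms(1)
  by (auto simp: tbracket_def tensor_completion_def inj_eq)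


section \<open>Lipschitz paths\<close>

lemma lipschitz_dominates: "L-lipschitz_on {a..b} \<gamma> \<Longrightarrow> dominates (\<lambda>t. L * t) \<gamma> a b"
  unfolding dominates_def
proof (intro allI impI)
  fix s t assume "L-lipschitz_on {a..b} \<gamma>" "a \<le> s" "s \<le> t" "t \<le> b"
  then show "norm (\<gamma> t - \<gamma> s) \<le> L * t - L * s"
    using lipschitz_onD[of L "{a..b}" \<gamma> t s] by (simp add: dist_norm right_diff_distrib)
qed

text \<open>A Hoelder bound of exponent \<open>1 / p\<close> suffices because the lengths of the
  intervals of a partition add up to \<open>T\<close>. All upper bounds on variation in the
  construction go through this criterion.\<close>

lemma pvar_le_of_powr_le:
  assumes "p > 0" "R \<ge> 0" "T \<ge> 0"
    and le: "\<And>s t. 0 \<le> s \<Longrightarrow> s < t \<Longrightarrow> t \<le> T \<Longrightarrow> norm (\<alpha> (s, t)) powr p \<le> R * (t - s)"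
  shows "pvar p T \<alpha> \<le> ennreal ((R * T) powr (1 / p))"
proof (rule pvar_le)
  fix D assume D: "D \<in> partitions T"
  have psum: "psum h xs \<le> R * (last xs - hd xs)"
    if "xs \<noteq> []" "sorted_wrt (<) xs" "\<And>s t. s \<in> set xs \<Longrightarrow> t \<in> set xs \<Longrightarrow> s < t \<Longrightarrow> h (s, t) \<le> R * (t - s)"
    for h :: "real \<times> real \<Rightarrow> real" and xs
    using that
  proof (induction h xs rule: psum.induct)
    case (1 h x y ys)
    have "psum h (y # ys) \<le> R * (last (y # ys) - hd (y # ys))"
      using 1(2-4) by (intro 1(1)) auto
    moreover have "h (x, y) \<le> R * (y - x)" using 1(3,4) by simp
    ultimately show ?case by (simp add: algebra_simps)
  qed auto
  have mem: "set D \<subseteq> {0..T}"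
  proof
    fix x assume x: "x \<in> set D"
    have "\<forall>x\<in>set D. hd D \<le> x \<and> x \<le> last D" if "sorted_wrt (<) D" for D :: "real list"
      using that by (induction D) (auto simp: less_imp_le)
    from this[of D] show "x \<in> {0..T}" using D x by (auto simp: partitions_def)
  qed
  have "psum (\<lambda>x. norm (\<alpha> x) powr p) D \<le> R * (last D - hd D)"
  proof (rule psum)
    show "D \<noteq> []" "sorted_wrt (<) D" using D by (auto simp: partitions_def)
    show "norm (\<alpha> (s, t)) powr p \<le> R * (t - s)" if "s \<in> set D" "t \<in> set D" "s < t" for s t
      using le[of s t] mem that by (simp add: subset_iff)
  qed
  then show "pvar_sum p \<alpha> D \<le> R * T"
    using D by (simp add: pvar_sum_eq_psum partitions_def)
qed (use assms in auto)

lemma lipschitz_C1var: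
  assumes "L-lipschitz_on {0..T} \<gamma>" "T \<ge> 0"
  shows "\<gamma> \<in> C1var T"
proof -
  have "pvar 1 T (increments \<gamma>) \<le> ennreal ((L * T) powr (1 / 1))"
    using lipschitz_on_nonneg[OF assms(1)] dominatesD[OF lipschitz_dominates[OF assms(1)]] assms(2)
    by (intro pvar_le_of_powr_le) (auto simp: increments_def right_diff_distrib)
  then have "pvar 1 T (increments \<gamma>) < \<infinity>" using le_less_trans by fastforce
  then show ?thesis using lipschitz_on_continuous_on[OF assms(1)] by (simp add: C1var_def)
qed

text \<open>Cutting into \<open>m\<close> equal pieces gives \<open>m\<close> terms of order
  \<open>1 / m^2\<close>, so the total is at most of order \<open>1 / m\<close> for every
  \<open>m\<close>.\<close>

lemma additive_quadratic_zero:
  fixes F :: "real \<times> real \<Rightarrow> 'a::real_normed_vector"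
  assumes "s \<le> t"
    and add: "\<And>x y. s \<le> x \<Longrightarrow> x \<le> y \<Longrightarrow> y \<le> t \<Longrightarrow> F (s, y) = F (s, x) + F (x, y)"
    and C: "\<And>x y. s \<le> x \<Longrightarrow> x \<le> y \<Longrightarrow> y \<le> t \<Longrightarrow> norm (F (x, y)) \<le> C * (y - x)\<^sup>2"
  shows "F (s, t) = 0"
proof (cases "s = t")
  case True
  then show ?thesis using C[of s s] by simp
next
  case False
  then have st: "s < t" using assms by simp
  have diag: "F (s, s) = 0" using C[of s s] st by simp
  have le: "norm (F (s, t)) \<le> C * (t - s)\<^sup>2 / real m" if m: "m > 0" for m
  proof -
    let ?x = "unif_part s t m"
    have "norm (F (?x j, ?x (Suc j))) \<le> C * ((t - s) / m)\<^sup>2" if "j < m" for j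
    proof -
      have "?x j \<le> ?x (Suc j)" using unif_part_strict_mono[OF st m] by (simp add: strict_mono_less_eq)
      then have "norm (F (?x j, ?x (Suc j))) \<le> C * (?x (Suc j) - ?x j)\<^sup>2"
        using unif_part_mem[OF st m, of j] unif_part_mem[OF st m, of "Suc j"] that
        by (intro C) simp_all
      then show ?thesis by (simp only: unif_part_step[OF m])
    qed
    then have "(\<Sum>j<m. norm (F (?x j, ?x (Suc j)))) \<le> (\<Sum>j<m. C * ((t - s) / m)\<^sup>2)"
      by (intro sum_mono) auto
    also have "\<dots> = C * (t - s)\<^sup>2 / m" using m by (simp add: power2_eq_square)
    finally have "(\<Sum>j<m. norm (F (?x j, ?x (Suc j)))) \<le> C * (t - s)\<^sup>2 / m" .
    moreover have "F (s, t) = (\<Sum>j<m. F (?x j, ?x (Suc j)))"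
      by (rule unif_part_additive[where F = F and s = s and t = t and m = m, OF st m diag add])
    ultimately show ?thesis
      using norm_sum[of "\<lambda>j. F (?x j, ?x (Suc j))" "{..<m}"] by simp
  qed
  have "norm (F (s, t)) \<le> 0"
  proof (rule LIMSEQ_le_const)
    show "(\<lambda>m. C * (t - s)\<^sup>2 / real m) \<longlonglongrightarrow> 0"
      by (rule real_tendsto_divide_at_top[OF tendsto_const filterlim_real_sequentially])
    show "\<exists>N. \<forall>m\<ge>N. norm (F (s, t)) \<le> C * (t - s)\<^sup>2 / real m"
      using le by (intro exI[of _ 1]) auto
  qed
  then show ?thesis by simp
qed

lemma norm_area_lipschitz_le:
  assumes \<iota>: "tensor_completion \<iota>" and \<gamma>: "L-lipschitz_on {s..t} \<gamma>" and "s \<le> t"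
  shows "norm (area \<iota> \<gamma> (s, t)) \<le> L\<^sup>2 * (t - s)\<^sup>2"
proof -
  have "norm (area \<iota> \<gamma> (s, t)) \<le> L * (t - s) * (L * t - L * s)"
  proof (rule norm_area_le[OF \<iota> \<open>s \<le> t\<close> lipschitz_on_continuous_on[OF \<gamma>] lipschitz_dominates[OF \<gamma>]])
    show "norm (\<gamma> z - \<gamma> s) \<le> L * (t - s)" if "z \<in> {s..t}" for z
      using dominatesD[OF lipschitz_dominates[OF \<gamma>], of s z] mult_left_mono[of "z - s" "t - s" L]
        lipschitz_on_nonneg[OF \<gamma>] that by (simp add: right_diff_distrib)
  qed
  then show ?thesis by (simp add: power2_eq_square algebra_simps)
qed

text \<open>The bracket terms of the two Chen relations agree, so the difference is additive; for a
  Lipschitz path the area itself is quadratically small, hence so is the difference.\<close>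

lemma area_unique:
  fixes a :: "real \<times> real \<Rightarrow> 'w::banach"
  assumes \<iota>: "tensor_completion \<iota>" and \<gamma>: "L-lipschitz_on {0..T} \<gamma>"
    and chen: "\<And>s t u. 0 \<le> s \<Longrightarrow> s \<le> t \<Longrightarrow> t \<le> u \<Longrightarrow> u \<le> T \<Longrightarrow>
      a (s, u) = a (s, t) + a (t, u) + (1 / 2) *\<^sub>R tbracket \<iota> (\<gamma> t - \<gamma> s) (\<gamma> u - \<gamma> t)"
    and C: "\<And>s t. 0 \<le> s \<Longrightarrow> s \<le> t \<Longrightarrow> t \<le> T \<Longrightarrow> norm (a (s, t)) \<le> C * (t - s)\<^sup>2"
    and st: "0 \<le> s" "s \<le> t" "t \<le> T"
  shows "area \<iota> \<gamma> (s, t) = a (s, t)"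
proof -
  define F where "F x = area \<iota> \<gamma> x - a x" for x
  have cont: "continuous_on {x..y} \<gamma>" if "0 \<le> x" "y \<le> T" for x y
    using lipschitz_on_continuous_on[OF \<gamma>] that by (auto elim: continuous_on_subset)
  have dom: "dominates (\<lambda>t. L * t) \<gamma> x y" if "0 \<le> x" "y \<le> T" for x y
    using lipschitz_dominates[OF \<gamma>] that by (rule dominates_subset)
  have "F (s, t) = 0"
  proof (rule additive_quadratic_zero[where C = "L\<^sup>2 + C"])
    show "F (s, y) = F (s, x) + F (x, y)" if "s \<le> x" "x \<le> y" "y \<le> t" for x y
      using area_chen[OF \<iota> that(1,2) cont dom] chen[of s x y] that st by (simp add: F_def)
    show "norm (F (x, y)) \<le> (L\<^sup>2 + C) * (y - x)\<^sup>2" if "s \<le> x" "x \<le> y" "y \<le> t" for x y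
    proof -
      have "norm (area \<iota> \<gamma> (x, y)) \<le> L\<^sup>2 * (y - x)\<^sup>2"
        using that st by (intro norm_area_lipschitz_le[OF \<iota>] lipschitz_on_subset[OF \<gamma>]) auto
      then show ?thesis
        using norm_triangle_ineq4[of "area \<iota> \<gamma> (x, y)" "a (x, y)"] C[of x y] that st
        by (simp add: F_def distrib_right)
    qed
  qed (use st in auto)
  then show ?thesis by (simp add: F_def)
qed

lemma norm_iter_int_lipschitz_le:
  assumes \<iota>: "tensor_completion \<iota>" and \<gamma>: "L-lipschitz_on {s..t} \<gamma>" and l: "continuous_on {s..t} l" and "s \<le> t"
    and M: "\<And>u. u \<in> {s..t} \<Longrightarrow> norm (l u - l s) \<le> M"
  shows "norm (iter_int (tbracket \<iota>) l \<gamma> s t) \<le> 2 * M * L * (t - s)"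
  using iter_int_norm_le[OF bounded_bilinear_tbracket[OF \<iota>] norm_tbracket_le[OF \<iota>] _ \<open>s \<le> t\<close> l
      lipschitz_dominates[OF \<gamma>] M]
  by (simp add: algebra_simps)

text \<open>The cross terms are written with the integral against the path \<open>\<gamma>\<close> only, by integration by
  parts; hence they are small when \<open>l\<close> is uniformly small, however large its speed.\<close>

lemma area_add:
  assumes \<iota>: "tensor_completion \<iota>" and \<gamma>: "L-lipschitz_on {0..T} \<gamma>" and l: "L'-lipschitz_on {0..T} l"
    and st: "0 \<le> s" "s \<le> t" "t \<le> T"
  shows "area \<iota> (\<lambda>u. \<gamma> u + l u) (s, t) = area \<iota> \<gamma> (s, t) + area \<iota> l (s, t)
      + (1 / 2) *\<^sub>R tbracket \<iota> (\<gamma> t - \<gamma> s) (l t - l s) + iter_int (tbracket \<iota>) l \<gamma> s t"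
proof -
  interpret B: bounded_bilinear "tbracket \<iota>" by (rule bounded_bilinear_tbracket[OF \<iota>])
  define a where "a = (\<lambda>(s, t). area \<iota> \<gamma> (s, t) + area \<iota> l (s, t)
      + (1 / 2) *\<^sub>R tbracket \<iota> (\<gamma> t - \<gamma> s) (l t - l s) + iter_int (tbracket \<iota>) l \<gamma> s t)"
  have lip: "L-lipschitz_on {x..y} \<gamma>" "L'-lipschitz_on {x..y} l" if "0 \<le> x" "y \<le> T" for x y
    using lipschitz_on_subset[OF \<gamma>] lipschitz_on_subset[OF l] that by auto
  have L: "L \<ge> 0" "L' \<ge> 0" using lipschitz_on_nonneg \<gamma> l by auto
  have "area \<iota> (\<lambda>u. \<gamma> u + l u) (s, t) = a (s, t)"
  proof (rule area_unique[OF \<iota> lipschitz_on_add[OF \<gamma> l] _ _ st])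
    fix x y z assume xyz: "0 \<le> x" "x \<le> y" "y \<le> z" "z \<le> T"
    note lipxz = lip[OF xyz(1,4)]
    define A where "A = tbracket \<iota> (\<gamma> y - \<gamma> x) (\<gamma> z - \<gamma> y)"
    define B where "B = tbracket \<iota> (l y - l x) (l z - l y)"
    define C where "C = tbracket \<iota> (\<gamma> y - \<gamma> x) (l z - l y)"
    define D where "D = tbracket \<iota> (l y - l x) (\<gamma> z - \<gamma> y)"
    have "tbracket \<iota> (\<gamma> z - \<gamma> x) (l z - l x)
        = tbracket \<iota> ((\<gamma> y - \<gamma> x) + (\<gamma> z - \<gamma> y)) ((l y - l x) + (l z - l y))" by simp
    also have "\<dots> = tbracket \<iota> (\<gamma> y - \<gamma> x) (l y - l x) + C + tbracket \<iota> (\<gamma> z - \<gamma> y) (l z - l y) - D"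
      unfolding C_def D_def B.add_left B.add_right tbracket_swap[of \<iota> "\<gamma> z - \<gamma> y" "l y - l x"]
      by simp
    finally have 1: "tbracket \<iota> (\<gamma> z - \<gamma> x) (l z - l x) = \<dots>" .
    have 2: "tbracket \<iota> (\<gamma> y + l y - (\<gamma> x + l x)) (\<gamma> z + l z - (\<gamma> y + l y)) = A + B + C + D"
    proof -
      have "tbracket \<iota> (\<gamma> y + l y - (\<gamma> x + l x)) (\<gamma> z + l z - (\<gamma> y + l y))
        = tbracket \<iota> ((\<gamma> y - \<gamma> x) + (l y - l x)) ((\<gamma> z - \<gamma> y) + (l z - l y))"
        by (simp add: algebra_simps)
      then show ?thesis unfolding A_def B_def C_def D_def B.add_left B.add_right by simp
    qed
    have 3: "area \<iota> \<gamma> (x, z) = area \<iota> \<gamma> (x, y) + area \<iota> \<gamma> (y, z) + (1 / 2) *\<^sub>R A"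
      unfolding A_def by (rule area_chen[OF \<iota> xyz(2,3) lipschitz_on_continuous_on[OF lipxz(1)] lipschitz_dominates[OF lipxz(1)]])
    have 4: "area \<iota> l (x, z) = area \<iota> l (x, y) + area \<iota> l (y, z) + (1 / 2) *\<^sub>R B"
      unfolding B_def by (rule area_chen[OF \<iota> xyz(2,3) lipschitz_on_continuous_on[OF lipxz(2)] lipschitz_dominates[OF lipxz(2)]])
    have 5: "iter_int (tbracket \<iota>) l \<gamma> x z = iter_int (tbracket \<iota>) l \<gamma> x y + iter_int (tbracket \<iota>) l \<gamma> y z + D"
      unfolding D_def
      by (rule iter_int_chen[OF bounded_bilinear_tbracket[OF \<iota>] xyz(2,3)
            lipschitz_on_continuous_on[OF lipxz(2)] lipschitz_dominates[OF lipxz(1)]])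
    \<comment> \<open>The bracket of the two increments contributes \<open>(C - D) / 2\<close> and
      Chen's relation for the iterated integral contributes \<open>D\<close>. Together they give
      \<open>(C + D) / 2\<close>, as the bracket of the summed path demands.\<close>
    have half: "D - (1/2) *\<^sub>R D = (1/2) *\<^sub>R D"
      using scaleR_left_diff_distrib[of 1 "1/2" D] by simp
    show "a (x, z) = a (x, y) + a (y, z)
        + (1 / 2) *\<^sub>R tbracket \<iota> (\<gamma> y + l y - (\<gamma> x + l x)) (\<gamma> z + l z - (\<gamma> y + l y))"
      unfolding a_def split 1 2 3 4 5 scaleR_add_right scaleR_diff_right
      using half by (simp add: algebra_simps)
  next
    fix x y assume xy: "0 \<le> x" "x \<le> y" "y \<le> T"
    have \<gamma>l: "norm (\<gamma> y - \<gamma> x) \<le> L * (y - x)" "norm (l u - l x) \<le> L' * (y - x)" if "u \<in> {x..y}" for u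
      using lipschitz_onD[OF lip(1)[OF xy(1,3)], of y x] lipschitz_onD[OF lip(2)[OF xy(1,3)], of u x]
        mult_left_mono[of "u - x" "y - x" L'] L that xy by (auto simp: dist_norm)
    have "norm (area \<iota> \<gamma> (x, y)) \<le> L\<^sup>2 * (y - x)\<^sup>2"
      by (rule norm_area_lipschitz_le[OF \<iota> lip(1)[OF xy(1,3)] xy(2)])
    moreover have "norm (area \<iota> l (x, y)) \<le> L'\<^sup>2 * (y - x)\<^sup>2"
      by (rule norm_area_lipschitz_le[OF \<iota> lip(2)[OF xy(1,3)] xy(2)])
    moreover have "norm ((1 / 2) *\<^sub>R tbracket \<iota> (\<gamma> y - \<gamma> x) (l y - l x)) \<le> L * L' * (y - x)\<^sup>2"
    proof -
      have "norm (tbracket \<iota> (\<gamma> y - \<gamma> x) (l y - l x)) \<le> norm (\<gamma> y - \<gamma> x) * norm (l y - l x) * 2"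
        by (rule norm_tbracket_le[OF \<iota>])
      also have "\<dots> \<le> (L * (y - x)) * (L' * (y - x)) * 2"
        using \<gamma>l[of y] xy L by (intro mult_right_mono mult_mono) auto
      finally show ?thesis by (simp add: power2_eq_square algebra_simps)
    qed
    moreover have "norm (iter_int (tbracket \<iota>) l \<gamma> x y) \<le> 2 * (L * L') * (y - x)\<^sup>2"
      using norm_iter_int_lipschitz_le[OF \<iota> lip(1)[OF xy(1,3)] lipschitz_on_continuous_on[OF lip(2)[OF xy(1,3)]] xy(2), of "L' * (y - x)"]
        \<gamma>l(2) by (simp add: power2_eq_square mult_ac)
    moreover have "norm (a (x, y)) \<le> norm (area \<iota> \<gamma> (x, y)) + norm (area \<iota> l (x, y))
        + norm ((1 / 2) *\<^sub>R tbracket \<iota> (\<gamma> y - \<gamma> x) (l y - l x)) + norm (iter_int (tbracket \<iota>) l \<gamma> x y)"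
      unfolding a_def split by (intro norm_triangle_le add_right_mono norm_triangle_ineq order_refl)
    ultimately show "norm (a (x, y)) \<le> (L\<^sup>2 + L'\<^sup>2 + L * L' + 2 * (L * L')) * (y - x)\<^sup>2"
      unfolding distrib_right by linarith
  qed
  then show ?thesis by (simp add: a_def)
qed

section \<open>Superposition of small fast circles\<close>

definition circ :: "real \<Rightarrow> real \<Rightarrow> 'a::real_vector \<Rightarrow> 'a \<Rightarrow> real \<Rightarrow> 'a" where
  "circ r \<omega> a b t = (r * cos (\<omega> * t)) *\<^sub>R a + (r * sin (\<omega> * t)) *\<^sub>R b"

lemma abs_cos_diff_le: "\<bar>cos x - cos y\<bar> \<le> min 2 \<bar>x - y\<bar>" for x y :: real
proof -
  have "\<bar>cos x - cos y\<bar> = 2 * \<bar>sin ((x + y) / 2)\<bar> * \<bar>sin ((y - x) / 2)\<bar>"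
    by (simp add: cos_diff_cos abs_mult)
  moreover have "\<bar>sin ((x + y) / 2)\<bar> * \<bar>sin ((y - x) / 2)\<bar> \<le> 1 * \<bar>(y - x) / 2\<bar>"
    by (intro mult_mono abs_sin_x_le_abs_x) auto
  moreover have "\<bar>sin ((x + y) / 2)\<bar> * \<bar>sin ((y - x) / 2)\<bar> \<le> 1 * 1"
    by (intro mult_mono) auto
  ultimately show ?thesis by (simp add: abs_minus_commute)
qed

lemma abs_sin_diff_le: "\<bar>sin x - sin y\<bar> \<le> min 2 \<bar>x - y\<bar>" for x y :: real
  using abs_cos_diff_le[of "pi / 2 - x" "pi / 2 - y"] by (simp add: cos_diff abs_minus_commute)

text \<open>The minimum records the two regimes: bounded size over long times, bounded speed over
  short ones.\<close>

lemma circ_incr_le: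
  assumes "r \<ge> 0" "\<omega> \<ge> 0"
  shows "norm (circ r \<omega> a b t - circ r \<omega> a b s) \<le> r * (norm a + norm b) * min 2 (\<omega> * \<bar>t - s\<bar>)"
proof -
  have le: "\<bar>cos (\<omega> * t) - cos (\<omega> * s)\<bar> \<le> min 2 (\<omega> * \<bar>t - s\<bar>)"
    "\<bar>sin (\<omega> * t) - sin (\<omega> * s)\<bar> \<le> min 2 (\<omega> * \<bar>t - s\<bar>)"
    using abs_cos_diff_le[of "\<omega> * t" "\<omega> * s"] abs_sin_diff_le[of "\<omega> * t" "\<omega> * s"] assms
    by (auto simp: right_diff_distrib[symmetric] abs_mult)
  have "circ r \<omega> a b t - circ r \<omega> a b s
      = (r * (cos (\<omega> * t) - cos (\<omega> * s))) *\<^sub>R a + (r * (sin (\<omega> * t) - sin (\<omega> * s))) *\<^sub>R b"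
    by (simp add: circ_def algebra_simps)
  also have "norm \<dots> \<le> r * \<bar>cos (\<omega> * t) - cos (\<omega> * s)\<bar> * norm a + r * \<bar>sin (\<omega> * t) - sin (\<omega> * s)\<bar> * norm b"
    using assms by (intro norm_triangle_le) (simp add: abs_mult)
  also have "\<dots> \<le> r * min 2 (\<omega> * \<bar>t - s\<bar>) * norm a + r * min 2 (\<omega> * \<bar>t - s\<bar>) * norm b"
    using le assms by (intro add_mono mult_right_mono mult_left_mono) auto
  finally show ?thesis by (simp add: algebra_simps)
qed

lemma circ_lipschitz:
  assumes "r \<ge> 0" "\<omega> \<ge> 0"
  shows "(r * (norm a + norm b) * \<omega>)-lipschitz_on X (circ r \<omega> a b)"
proof (rule lipschitz_onI)
  fix x y
  have "norm (circ r \<omega> a b x - circ r \<omega> a b y) \<le> r * (norm a + norm b) * min 2 (\<omega> * \<bar>x - y\<bar>)"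
    by (rule circ_incr_le[OF assms])
  also have "\<dots> \<le> r * (norm a + norm b) * (\<omega> * \<bar>x - y\<bar>)"
    using assms by (intro mult_left_mono) auto
  finally show "dist (circ r \<omega> a b x) (circ r \<omega> a b y) \<le> r * (norm a + norm b) * \<omega> * dist x y"
    by (simp add: dist_norm)
qed (use assms in simp)

text \<open>Crude near zero, but quadratic order is exactly what \<open>area_unique\<close> asks
  for.\<close>

lemma abs_x_minus_sin_le: "\<bar>x - sin x\<bar> \<le> x\<^sup>2" for x :: real
proof -
  have "(\<Sum>m<2. sin_coeff m * x ^ m) = x" by (simp add: numeral_2_eq_2 sin_coeff_def)
  then have "\<bar>sin x - x\<bar> \<le> inverse 2 * \<bar>x\<bar>\<^sup>2"
    using Maclaurin_sin_bound[of x 2] by (simp only: fact_2)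
  moreover have "inverse 2 * \<bar>x\<bar>\<^sup>2 = x\<^sup>2 / 2" "x\<^sup>2 \<ge> 0" by simp_all
  ultimately show ?thesis unfolding abs_minus_commute[of x] by linarith
qed

text \<open>The bracket is alternating, so on the plane of \<open>a\<close> and \<open>b\<close> it
  is the determinant of the coordinates times one fixed vector.\<close>

lemma bracket_combination:
  assumes "tensor_completion \<iota>"
  shows "tbracket \<iota> (x *\<^sub>R a + y *\<^sub>R b) (x' *\<^sub>R a + y' *\<^sub>R b) = (x * y' - y * x') *\<^sub>R tbracket \<iota> a b"
proof -
  interpret B: bounded_bilinear "tbracket \<iota>" by (rule bounded_bilinear_tbracket[OF assms])
  have "tbracket \<iota> a a = 0" "tbracket \<iota> b b = 0" by (simp_all add: tbracket_def)
  then show ?thesis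
    unfolding B.add_left B.add_right B.scaleR_left B.scaleR_right tbracket_swap[of \<iota> b a]
    by (simp add: algebra_simps)
qed

text \<open>The coefficient is the area of a circular segment, sector minus triangle. Chen's
  relation for it is the subtraction formula for the sine.\<close>

lemma area_circ:
  assumes \<iota>: "tensor_completion \<iota>" and r: "r \<ge> 0" "\<omega> > 0" and st: "0 \<le> s" "s \<le> t" "t \<le> T"
  shows "area \<iota> (circ r \<omega> a b) (s, t) =
    (r\<^sup>2 / 2 * (\<omega> * (t - s) - sin (\<omega> * (t - s)))) *\<^sub>R tbracket \<iota> a b"
proof -
  define q where "q = (\<lambda>(s, t). (r\<^sup>2 / 2 * (\<omega> * (t - s) - sin (\<omega> * (t - s)))) *\<^sub>R tbracket \<iota> a b)"
  have "area \<iota> (circ r \<omega> a b) (s, t) = q (s, t)"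
  proof (rule area_unique[OF \<iota> circ_lipschitz _ _ st])
    fix x y z
    let ?c = "\<lambda>x. cos (\<omega> * x)" and ?s = "\<lambda>x. sin (\<omega> * x)"
    have incr: "circ r \<omega> a b v - circ r \<omega> a b u = (r * (?c v - ?c u)) *\<^sub>R a + (r * (?s v - ?s u)) *\<^sub>R b" for u v
      by (simp add: circ_def algebra_simps)
    have sin: "sin (\<omega> * (v - u)) = ?s v * ?c u - ?c v * ?s u" for u v
      by (simp add: right_diff_distrib sin_diff)
    show "q (x, z) = q (x, y) + q (y, z)
        + (1/2) *\<^sub>R tbracket \<iota> (circ r \<omega> a b y - circ r \<omega> a b x) (circ r \<omega> a b z - circ r \<omega> a b y)"
      unfolding q_def split incr bracket_combination[OF \<iota>] scaleR_scaleR scaleR_add_left[symmetric] sin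
      by (rule arg_cong[of _ _ "\<lambda>x. x *\<^sub>R _"]) (simp add: power2_eq_square field_simps)
  next
    fix x y :: real
    have "norm (q (x, y)) = r\<^sup>2 / 2 * \<bar>\<omega> * (y - x) - sin (\<omega> * (y - x))\<bar> * norm (tbracket \<iota> a b)"
      by (simp add: q_def abs_mult)
    also have "\<dots> \<le> r\<^sup>2 / 2 * (\<omega> * (y - x))\<^sup>2 * norm (tbracket \<iota> a b)"
      by (intro mult_right_mono mult_left_mono abs_x_minus_sin_le) auto
    finally show "norm (q (x, y)) \<le> r\<^sup>2 / 2 * \<omega>\<^sup>2 * norm (tbracket \<iota> a b) * (y - x)\<^sup>2"
      by (simp add: power_mult_distrib mult_ac)
  qed (use r in auto)
  then show ?thesis by (simp add: q_def)
qed

text \<open>\<open>K\<close> controls the 2-variation; \<open>M\<close> and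
  \<open>\<epsilon>\<close> are the two bounds that are later interpolated to control the
  \<open>p\<close>-variation of the area error. The Lipschitz constant is only asserted to exist,
  since no uniform bound on it survives the addition of fast circles.\<close>

definition area_approx ::
  "(('a::real_normed_vector, 'a) alg_tensor \<Rightarrow> 'w::banach) \<Rightarrow> real \<Rightarrow> 'w \<Rightarrow>
   real \<Rightarrow> real \<Rightarrow> real \<Rightarrow> real \<Rightarrow> (real \<Rightarrow> 'a) \<Rightarrow> bool" where
  "area_approx \<iota> T w c K M \<epsilon> \<gamma> \<longleftrightarrow> (\<exists>L. L-lipschitz_on {0..T} \<gamma>) \<and>
     (\<forall>s t. 0 \<le> s \<longrightarrow> s \<le> t \<longrightarrow> t \<le> T \<longrightarrow>
        norm (\<gamma> t - \<gamma> s) \<le> K * sqrt (t - s) \<and>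
        norm (area \<iota> \<gamma> (s, t)) \<le> M * (t - s) \<and>
        norm (area \<iota> \<gamma> (s, t) - (c * (t - s)) *\<^sub>R w) \<le> \<epsilon>)"

lemma area_approx_mono:
  assumes "area_approx \<iota> T w c K M \<epsilon> \<gamma>" "K \<le> K'" "M \<le> M'" "\<epsilon> \<le> \<epsilon>'"
  shows "area_approx \<iota> T w c K' M' \<epsilon>' \<gamma>"
proof -
  have "K * sqrt (t - s) \<le> K' * sqrt (t - s)" "M * (t - s) \<le> M' * (t - s)" if "s \<le> t" for s t :: real
    using that assms by (auto intro: mult_right_mono)
  then show ?thesis using assms unfolding area_approx_def by (meson order_trans)
qed

text \<open>Merges the two regimes of \<open>circ_incr_le\<close> into one Hoelder bound of exponent
  1/2.\<close>

lemma min_two_le_sqrt: "min 2 x \<le> 2 * sqrt x" if "x \<ge> 0" for x :: real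
proof (cases "x \<le> 1")
  case True
  then have "x * x \<le> x" using that mult_left_le by blast
  then have "x \<le> sqrt x" using that by (intro real_le_rsqrt) (simp add: power2_eq_square)
  then show ?thesis using that by (simp add: min_le_iff_disj)
next
  case False
  then have "1 \<le> sqrt x" by simp
  then show ?thesis by (simp add: min_le_iff_disj)
qed

text \<open>At each length scale at most one of the two paths is visible: increments over \<open>t - s \<le> \<eta>\<close> of
  the old Lipschitz path are small against \<open>sqrt (t - s)\<close>, and so are increments of the circle
  over \<open>t - s > \<eta>\<close>. This is why the Hoelder constants do not add up.\<close>

lemma area_approx_add_circ:
  fixes a b :: "'a::real_normed_vector" and \<iota> :: "('a, 'a) alg_tensor \<Rightarrow> 'w::banach"
  assumes \<iota>: "tensor_completion \<iota>" and "\<rho> > 0" "\<delta> > 0" "T > 0" "K \<ge> 0"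
    and \<gamma>: "area_approx \<iota> T (tbracket \<iota> a b) c K M \<epsilon> \<gamma>"
  obtains \<gamma>' where "area_approx \<iota> T (tbracket \<iota> a b) (c + \<rho> / 2)
    (max K (2 * (norm a + norm b) * sqrt \<rho>) + \<delta>) (M + \<rho> * norm (tbracket \<iota> a b) + \<delta>) (\<epsilon> + \<delta>) \<gamma>'"
proof -
  define N where "N = norm a + norm b"
  define w where "w = tbracket \<iota> a b"
  have N: "N \<ge> 0" by (simp add: N_def)
  obtain L where L: "L-lipschitz_on {0..T} \<gamma>" using \<gamma> by (auto simp: area_approx_def)
  have L0: "L \<ge> 0" using lipschitz_on_nonneg[OF L] .
  \<comment> \<open>\<open>C\<close> dominates every coefficient that will multiply \<open>r\<close>
    in an error term, so one smallness condition on \<open>r\<close> covers all of them. The factor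
    \<open>2 * T\<close> leaves half of \<open>\<delta>\<close> for the oscillation of the circle's
    own area.\<close>
  define C where "C = 1 + 6 * N * L * (1 + 2 * T) + norm w + 2 * N * (L + 1)"
  have C_ge: "6 * N * L \<le> C" "6 * N * L * (2 * T) \<le> C" "norm w \<le> C" "2 * N * (L + 1) \<le> C"
    and C: "C \<ge> 1"
    using N L0 \<open>T > 0\<close> unfolding C_def distrib_left by (simp_all add: add_nonneg_nonneg)
  \<comment> \<open>The bound 1 gives \<open>r^2 \<le> r\<close>; the bound with the square of
    \<open>\<delta>\<close> is for the long time scales in the Hoelder estimate. The speed is then
    forced by the prescribed rate \<open>\<rho> / 2\<close>.\<close>
  define r where "r = min 1 (min (\<delta> / C) (\<delta>\<^sup>2 / C))"
  define \<omega> where "\<omega> = \<rho> / r\<^sup>2"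
  have r0: "r > 0" using C \<open>\<delta> > 0\<close> by (simp add: r_def)
  have \<omega>0: "\<omega> > 0" using r0 \<open>\<rho> > 0\<close> by (simp add: \<omega>_def)
  have r\<omega>: "r\<^sup>2 * \<omega> = \<rho>" using r0 by (simp add: \<omega>_def)
  have "r \<le> \<delta> / C" "r \<le> \<delta>\<^sup>2 / C" "r \<le> 1" by (simp_all add: r_def)
  then have rC: "r * C \<le> \<delta>" "r * C \<le> \<delta>\<^sup>2" using C by (simp_all add: pos_le_divide_eq)
  have r_le: "6 * r * N * L \<le> \<delta>" "6 * r * N * L * T \<le> \<delta> / 2" "r\<^sup>2 * norm w \<le> \<delta>" "2 * r * N * (L + 1) \<le> \<delta>\<^sup>2"
  proof -
    have *: "r * x \<le> \<delta>" "r * x \<le> \<delta>\<^sup>2" if "x \<le> C" for x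
      using mult_left_mono[OF that, of r] r0 rC by linarith+
    show "6 * r * N * L \<le> \<delta>" using *(1)[OF C_ge(1)] by (simp add: mult_ac)
    show "6 * r * N * L * T \<le> \<delta> / 2" using *(1)[OF C_ge(2)] by (simp add: mult_ac)
    show "2 * r * N * (L + 1) \<le> \<delta>\<^sup>2" using *(2)[OF C_ge(4)] by (simp add: mult_ac)
    have "r\<^sup>2 * norm w \<le> r * norm w"
      using r0 \<open>r \<le> 1\<close> by (intro mult_right_mono) (auto simp: power2_eq_square mult_left_le)
    then show "r\<^sup>2 * norm w \<le> \<delta>" using *(1)[OF C_ge(3)] by linarith
  qed
  define l where "l = circ r \<omega> a b"
  have l: "norm (l t - l s) \<le> 2 * r * N" "norm (l t - l s) \<le> 2 * N * sqrt \<rho> * sqrt \<bar>t - s\<bar>" for s t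
  proof -
    have le: "norm (l t - l s) \<le> r * N * min 2 (\<omega> * \<bar>t - s\<bar>)"
      unfolding l_def N_def using r0 \<omega>0 by (intro circ_incr_le) auto
    also have "\<dots> \<le> r * N * 2" using r0 N by (intro mult_left_mono) auto
    finally show "norm (l t - l s) \<le> 2 * r * N" by simp
    have "norm (l t - l s) \<le> r * N * (2 * sqrt (\<omega> * \<bar>t - s\<bar>))"
    proof (rule order_trans[OF le])
      show "r * N * min 2 (\<omega> * \<bar>t - s\<bar>) \<le> r * N * (2 * sqrt (\<omega> * \<bar>t - s\<bar>))"
        using r0 N \<omega>0 by (intro mult_left_mono min_two_le_sqrt) auto
    qed
    moreover have "r * sqrt (\<omega> * \<bar>t - s\<bar>) = sqrt \<rho> * sqrt \<bar>t - s\<bar>"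
      using r0 by (simp add: r\<omega>[symmetric] real_sqrt_mult)
    moreover have "r * N * (2 * sqrt (\<omega> * \<bar>t - s\<bar>)) = 2 * N * (r * sqrt (\<omega> * \<bar>t - s\<bar>))" by simp
    ultimately show "norm (l t - l s) \<le> 2 * N * sqrt \<rho> * sqrt \<bar>t - s\<bar>" by (simp only: mult.assoc)
  qed
  have l_lip: "(r * (norm a + norm b) * \<omega>)-lipschitz_on {0..T} l"
    unfolding l_def using r0 \<omega>0 by (intro circ_lipschitz) auto
  have hoelder: "norm (\<gamma> t + l t - (\<gamma> s + l s)) \<le> (max K (2 * N * sqrt \<rho>) + \<delta>) * sqrt (t - s)"
    if st: "0 \<le> s" "s \<le> t" "t \<le> T" for s t
  proof -
    have tri: "norm (\<gamma> t + l t - (\<gamma> s + l s)) \<le> norm (\<gamma> t - \<gamma> s) + norm (l t - l s)"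
      using norm_triangle_ineq[of "\<gamma> t - \<gamma> s" "l t - l s"] by (simp add: algebra_simps)
    define h where "h = sqrt (t - s)"
    have h: "h \<ge> 0" "t - s = h * h" using st by (auto simp: h_def)
    have \<gamma>K: "norm (\<gamma> t - \<gamma> s) \<le> K * h" using \<gamma> st by (simp add: area_approx_def h_def)
    have \<gamma>L: "norm (\<gamma> t - \<gamma> s) \<le> L * (h * h)"
      using lipschitz_onD[OF L, of t s] st h by (simp add: dist_norm)
    have lh: "norm (l t - l s) \<le> 2 * N * sqrt \<rho> * h" using l(2)[of t s] st by (simp add: h_def)
    \<comment> \<open>The threshold for \<open>t - s\<close> is the square of
      \<open>\<delta> / (L + 1)\<close>. Up to it the old path moves by at most
      \<open>\<delta> * h\<close>; beyond it the size \<open>2 * r * N\<close> of the circle is at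
      most \<open>\<delta> * h\<close>. Using \<open>L + 1\<close> instead of \<open>L\<close> also
      covers \<open>L = 0\<close>.\<close>
    show ?thesis
    proof (cases "(L + 1) * h \<le> \<delta>")
      case True
      then have "L * h \<le> \<delta>" using h(1) by (simp add: distrib_right)
      then have "L * (h * h) \<le> \<delta> * h" using mult_right_mono[of "L * h" \<delta> h] h(1) by (simp add: mult_ac)
      then have "norm (\<gamma> t + l t - (\<gamma> s + l s)) \<le> (2 * N * sqrt \<rho> + \<delta>) * h"
        using tri \<gamma>L lh by (simp add: distrib_right)
      also have "\<dots> \<le> (max K (2 * N * sqrt \<rho>) + \<delta>) * h" using h by (intro mult_right_mono) auto
      finally show ?thesis by (simp add: h_def)
    next
      case False
      have "\<delta>\<^sup>2 \<le> \<delta> * ((L + 1) * h)"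
        unfolding power2_eq_square using False \<open>\<delta> > 0\<close> by (intro mult_left_mono) auto
      with r_le(4) have "2 * r * N * (L + 1) \<le> \<delta> * ((L + 1) * h)" by (rule order_trans)
      then have "(2 * r * N) * (L + 1) \<le> (\<delta> * h) * (L + 1)" by (simp add: mult_ac)
      then have "2 * r * N \<le> \<delta> * h" using L0 by (simp add: mult_le_cancel_right)
      then have "norm (\<gamma> t + l t - (\<gamma> s + l s)) \<le> (K + \<delta>) * h"
        using tri \<gamma>K l(1)[of t s] by (simp add: distrib_right)
      also have "\<dots> \<le> (max K (2 * N * sqrt \<rho>) + \<delta>) * h" using h by (intro mult_right_mono) auto
      finally show ?thesis by (simp add: h_def)
    qed
  qed
  have area: "norm (area \<iota> (\<lambda>u. \<gamma> u + l u) (s, t)) \<le> (M + \<rho> * norm w + \<delta>) * (t - s) \<and>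
      norm (area \<iota> (\<lambda>u. \<gamma> u + l u) (s, t) - ((c + \<rho> / 2) * (t - s)) *\<^sub>R w) \<le> \<epsilon> + \<delta>"
    if st: "0 \<le> s" "s \<le> t" "t \<le> T" for s t
  proof -
    define X where "X = (1 / 2) *\<^sub>R tbracket \<iota> (\<gamma> t - \<gamma> s) (l t - l s)"
    define J where "J = iter_int (tbracket \<iota>) l \<gamma> s t"
    define \<sigma> where "\<sigma> = sin (\<omega> * (t - s))"
    have "r\<^sup>2 / 2 * (\<omega> * (t - s) - \<sigma>) = \<rho> / 2 * (t - s) - r\<^sup>2 / 2 * \<sigma>"
      unfolding r\<omega>[symmetric] by (simp add: field_simps)
    then have circ: "area \<iota> l (s, t) = (\<rho> / 2 * (t - s) - r\<^sup>2 / 2 * \<sigma>) *\<^sub>R w"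
      unfolding l_def area_circ[OF \<iota> less_imp_le[OF r0] \<omega>0 st] w_def \<sigma>_def by simp
    have sum: "area \<iota> (\<lambda>u. \<gamma> u + l u) (s, t) = area \<iota> \<gamma> (s, t) + area \<iota> l (s, t) + X + J"
      unfolding X_def J_def by (rule area_add[OF \<iota> L l_lip st])
    have "norm (tbracket \<iota> (\<gamma> t - \<gamma> s) (l t - l s)) \<le> norm (\<gamma> t - \<gamma> s) * norm (l t - l s) * 2"
      by (rule norm_tbracket_le[OF \<iota>])
    also have "\<dots> \<le> (L * (t - s)) * (2 * r * N) * 2"
      using lipschitz_onD[OF L, of t s] st L0 by (intro mult_right_mono mult_mono l(1)) (auto simp: dist_norm)
    finally have X: "norm X \<le> 2 * r * N * L * (t - s)" by (simp add: X_def mult_ac)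
    have "norm J \<le> 2 * (2 * r * N) * L * (t - s)"
      unfolding J_def
    proof (rule norm_iter_int_lipschitz_le[OF \<iota> _ _ st(2) l(1)])
      show "L-lipschitz_on {s..t} \<gamma>" using st by (intro lipschitz_on_subset[OF L]) auto
      show "continuous_on {s..t} l" using lipschitz_on_continuous_on[OF l_lip] st by (auto elim: continuous_on_subset)
    qed
    then have XJ: "norm X + norm J \<le> 6 * r * N * L * (t - s)" using X by linarith
    have "6 * r * N * L * (t - s) \<le> \<delta> * (t - s)" using r_le(1) st by (intro mult_right_mono) auto
    then have XJ1: "norm X + norm J \<le> \<delta> * (t - s)" using XJ by linarith
    have "6 * r * N * L * (t - s) \<le> 6 * r * N * L * T" using st r0 N L0 by (intro mult_left_mono) auto
    then have XJ2: "norm X + norm J \<le> \<delta> / 2" using XJ r_le(2) by linarith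
    \<comment> \<open>Here the oscillating term must be linear in \<open>t - s\<close>, so the sine
      is bounded by its argument, which doubles the rate \<open>\<rho> / 2\<close>. In the uniform
      estimate further down it is bounded by 1 instead.\<close>
    have "norm (area \<iota> l (s, t)) \<le> \<rho> * (t - s) * norm w"
    proof -
      have "\<bar>\<sigma>\<bar> \<le> \<omega> * (t - s)" unfolding \<sigma>_def using abs_sin_x_le_abs_x[of "\<omega> * (t - s)"] \<omega>0 st by simp
      then have "r\<^sup>2 / 2 * \<bar>\<sigma>\<bar> \<le> r\<^sup>2 / 2 * (\<omega> * (t - s))" by (intro mult_left_mono) auto
      also have "\<dots> = \<rho> / 2 * (t - s)" by (simp add: r\<omega>[symmetric] mult_ac)
      finally have "\<bar>r\<^sup>2 / 2 * \<sigma>\<bar> \<le> \<rho> / 2 * (t - s)" by (simp add: abs_mult)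
      moreover have "0 \<le> \<rho> / 2 * (t - s)" using \<open>\<rho> > 0\<close> st by simp
      ultimately have "\<bar>\<rho> / 2 * (t - s) - r\<^sup>2 / 2 * \<sigma>\<bar> \<le> \<rho> * (t - s)" by linarith
      then show ?thesis unfolding circ norm_scaleR by (rule mult_right_mono) simp
    qed
    moreover have "norm (area \<iota> \<gamma> (s, t)) \<le> M * (t - s)" using \<gamma> st by (simp add: area_approx_def)
    moreover have "norm (area \<iota> (\<lambda>u. \<gamma> u + l u) (s, t)) \<le> norm (area \<iota> \<gamma> (s, t)) + norm (area \<iota> l (s, t)) + norm X + norm J"
      unfolding sum by (intro norm_triangle_le add_right_mono norm_triangle_ineq order_refl)
    ultimately have "norm (area \<iota> (\<lambda>u. \<gamma> u + l u) (s, t)) \<le> M * (t - s) + \<rho> * (t - s) * norm w + \<delta> * (t - s)"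
      using XJ1 by linarith
    also have "\<dots> = (M + \<rho> * norm w + \<delta>) * (t - s)" by (simp add: algebra_simps)
    finally have 1: "norm (area \<iota> (\<lambda>u. \<gamma> u + l u) (s, t)) \<le> \<dots>" .
    have "area \<iota> (\<lambda>u. \<gamma> u + l u) (s, t) - ((c + \<rho> / 2) * (t - s)) *\<^sub>R w
        = (area \<iota> \<gamma> (s, t) - (c * (t - s)) *\<^sub>R w) - (r\<^sup>2 / 2 * \<sigma>) *\<^sub>R w + X + J"
      unfolding sum circ by (simp add: algebra_simps)
    also have "norm \<dots> \<le> norm (area \<iota> \<gamma> (s, t) - (c * (t - s)) *\<^sub>R w) + norm ((r\<^sup>2 / 2 * \<sigma>) *\<^sub>R w) + norm X + norm J"
      by (intro norm_triangle_le add_right_mono norm_triangle_ineq4 order_refl)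
    also have "norm ((r\<^sup>2 / 2 * \<sigma>) *\<^sub>R w) \<le> \<delta> / 2"
    proof -
      have "\<bar>\<sigma>\<bar> \<le> 1" by (simp add: \<sigma>_def)
      then have "r\<^sup>2 * norm w * \<bar>\<sigma>\<bar> \<le> r\<^sup>2 * norm w * 1" by (intro mult_left_mono) auto
      then show ?thesis using r_le(3) by (simp add: abs_mult mult_ac)
    qed
    finally have "norm (area \<iota> (\<lambda>u. \<gamma> u + l u) (s, t) - ((c + \<rho> / 2) * (t - s)) *\<^sub>R w) \<le> \<epsilon> + \<delta>"
      using XJ2 \<gamma> st by (fastforce simp: area_approx_def w_def)
    with 1 show ?thesis ..
  qed
  have "area_approx \<iota> T w (c + \<rho> / 2) (max K (2 * N * sqrt \<rho>) + \<delta>) (M + \<rho> * norm w + \<delta>) (\<epsilon> + \<delta>) (\<lambda>u. \<gamma> u + l u)"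
    unfolding area_approx_def using lipschitz_on_add[OF L l_lip] hoelder area by blast
  then show ?thesis using that unfolding w_def N_def by blast
qed

lemma area_const:
  assumes "tensor_completion \<iota>" "s \<le> t"
  shows "area \<iota> (\<lambda>_. c) (s, t) = 0"
  using norm_area_le[OF assms, of "\<lambda>_. c" "\<lambda>_. 0" 0] by (simp add: dominates_def)

text \<open>Induction over the number of circles for all tolerances at once: half of
  \<open>\<delta>\<close> goes to the path built so far, half to the new circle. Because the Hoelder
  constants enter through a maximum, their bound does not depend on \<open>k\<close>, while the area
  rate grows linearly in \<open>k\<close>.\<close>

lemma area_approx_exists:
  fixes a b :: "'a::real_normed_vector" and \<iota> :: "('a, 'a) alg_tensor \<Rightarrow> 'w::banach"
  assumes \<iota>: "tensor_completion \<iota>" and "\<rho> > 0" "T > 0"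
  shows "\<delta> > 0 \<Longrightarrow> \<exists>\<gamma>. area_approx \<iota> T (tbracket \<iota> a b) (real k * \<rho> / 2)
    (2 * (norm a + norm b) * sqrt \<rho> + \<delta>) (real k * \<rho> * norm (tbracket \<iota> a b) + \<delta>) \<delta> \<gamma>"
proof (induction k arbitrary: \<delta>)
  case 0
  have "0-lipschitz_on {0..T} (\<lambda>_. 0 :: 'a)" by (rule lipschitz_onI) auto
  moreover have "0 \<le> 2 * (norm a + norm b) * sqrt \<rho> + \<delta>" using 0 \<open>\<rho> > 0\<close> by simp
  ultimately have "area_approx \<iota> T (tbracket \<iota> a b) (real 0 * \<rho> / 2)
    (2 * (norm a + norm b) * sqrt \<rho> + \<delta>) (real 0 * \<rho> * norm (tbracket \<iota> a b) + \<delta>) \<delta> (\<lambda>_. 0)"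
    using 0 unfolding area_approx_def by (auto simp: area_const[OF \<iota>])
  then show ?case by blast
next
  case (Suc k)
  let ?N = "2 * (norm a + norm b) * sqrt \<rho>"
  have d2: "\<delta> / 2 > 0" using Suc.prems by simp
  obtain \<gamma> where \<gamma>: "area_approx \<iota> T (tbracket \<iota> a b) (real k * \<rho> / 2) (?N + \<delta> / 2)
      (real k * \<rho> * norm (tbracket \<iota> a b) + \<delta> / 2) (\<delta> / 2) \<gamma>"
    using Suc.IH[OF d2] by blast
  have "?N + \<delta> / 2 \<ge> 0" using d2 \<open>\<rho> > 0\<close> by simp
  then obtain \<gamma>' where \<gamma>': "area_approx \<iota> T (tbracket \<iota> a b) (real k * \<rho> / 2 + \<rho> / 2)
      (max (?N + \<delta> / 2) ?N + \<delta> / 2)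
      (real k * \<rho> * norm (tbracket \<iota> a b) + \<delta> / 2 + \<rho> * norm (tbracket \<iota> a b) + \<delta> / 2) (\<delta> / 2 + \<delta> / 2) \<gamma>'"
    using area_approx_add_circ[OF \<iota> \<open>\<rho> > 0\<close> d2 \<open>T > 0\<close> _ \<gamma>] by blast
  have "real k * \<rho> / 2 + \<rho> / 2 = real (Suc k) * \<rho> / 2" by (simp add: field_simps)
  then have "area_approx \<iota> T (tbracket \<iota> a b) (real (Suc k) * \<rho> / 2) (?N + \<delta>)
      (real (Suc k) * \<rho> * norm (tbracket \<iota> a b) + \<delta>) \<delta> \<gamma>'"
    using Suc.prems by (intro area_approx_mono[OF \<gamma>'[unfolded \<open>_ = real (Suc k) * \<rho> / 2\<close>]])
      (simp_all add: distrib_right)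
  then show ?case by blast
qed

section \<open>Passage to the limit and failure of closability for p > 1\<close>

lemma pvar_tendsto_zero:
  assumes "\<And>n. pvar p T (\<beta> n) \<le> ennreal (x n)" "x \<longlonglongrightarrow> 0"
  shows "(\<lambda>n. pvar p T (\<beta> n)) \<longlonglongrightarrow> 0"
proof (rule tendsto_sandwich[OF _ _ tendsto_const])
  show "(\<lambda>n. ennreal (x n)) \<longlonglongrightarrow> 0" using tendsto_ennrealI[OF assms(2)] by simp
qed (use assms(1) in auto)

lemma zero_path_converges:
  fixes \<iota> :: "('a::real_normed_vector, 'a) alg_tensor \<Rightarrow> 'w::banach"
  assumes "tensor_completion \<iota>" "T > 0" "p > 0"
  shows "(\<lambda>_. 0 :: 'a) \<in> C1var T" "path_conv_pvar 2 T (\<lambda>_ _. 0 :: 'a) (\<lambda>_. 0)"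
    "conv_pvar p T (bracket_space \<iota>) (\<lambda>_. area \<iota> (\<lambda>_. 0)) (\<lambda>_. 0)"
proof -
  show "(\<lambda>_. 0 :: 'a) \<in> C1var T"
    using assms(2) by (intro lipschitz_C1var[where L = 0] lipschitz_onI) auto
  have "pvar 2 T (increments (\<lambda>_. 0 - 0 :: 'a)) \<le> ennreal ((0 * T) powr (1 / 2))"
    using assms(2) by (intro pvar_le_of_powr_le) (auto simp: increments_def)
  then show "path_conv_pvar 2 T (\<lambda>_ _. 0 :: 'a) (\<lambda>_. 0)" by (simp add: path_conv_pvar_def)
  have "pvar p T (\<lambda>x. area \<iota> (\<lambda>_. 0) x - 0) \<le> ennreal ((0 * T) powr (1 / p))"
    using assms by (intro pvar_le_of_powr_le) (auto simp: area_const)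
  moreover have "0 \<in> bracket_space \<iota>"
    unfolding bracket_space_def using closure_subset span_zero by blast
  ultimately show "conv_pvar p T (bracket_space \<iota>) (\<lambda>_. area \<iota> (\<lambda>_. 0)) (\<lambda>_. 0)"
    by (auto simp: conv_pvar_def)
qed

lemma area_linear_limit:
  fixes a b :: "'a::real_normed_vector" and \<iota> :: "('a, 'a) alg_tensor \<Rightarrow> 'w::banach"
  assumes \<iota>: "tensor_completion \<iota>" and T: "T > 0" and p: "p > 1"
  obtains \<gamma>s where "\<And>n. \<gamma>s n \<in> C1var T" "path_conv_pvar 2 T \<gamma>s (\<lambda>_. 0)"
    "conv_pvar p T (bracket_space \<iota>) (\<lambda>n. area \<iota> (\<gamma>s n)) (\<lambda>(s, t). ((t - s) / 2) *\<^sub>R tbracket \<iota> a b)"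
proof -
  define w where "w = tbracket \<iota> a b"
  \<comment> \<open>\<open>\<delta> n\<close> serves both as the parameter \<open>\<rho>\<close> of
    each circle and as the tolerance. With \<open>Suc n\<close> circles the total rate is exactly
    1/2, while the Hoelder constant \<open>K n\<close> tends to zero.\<close>
  define \<delta> where "\<delta> n = 1 / real (Suc n)" for n
  define K where "K n = 2 * (norm a + norm b) * sqrt (\<delta> n) + \<delta> n" for n
  have \<delta>: "\<delta> n > 0" "\<delta> n \<le> 1" "real (Suc n) * \<delta> n = 1" for n by (simp_all add: \<delta>_def)
  have \<delta>_lim: "\<delta> \<longlonglongrightarrow> 0" unfolding \<delta>_def using LIMSEQ_Suc[OF lim_1_over_n] by simp
  have "\<exists>\<gamma>. area_approx \<iota> T w (1 / 2) (K n) (norm w + 1) (\<delta> n) \<gamma>" for n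
  proof -
    obtain \<gamma> where "area_approx \<iota> T w (real (Suc n) * \<delta> n / 2) (K n) (real (Suc n) * \<delta> n * norm w + \<delta> n) (\<delta> n) \<gamma>"
      using area_approx_exists[OF \<iota> \<delta>(1) T \<delta>(1), where a = a and b = b and k = "Suc n"]
      unfolding w_def K_def by blast
    then have "area_approx \<iota> T w (1 / 2) (K n) (1 * norm w + \<delta> n) (\<delta> n) \<gamma>" unfolding \<delta>(3) .
    then have "area_approx \<iota> T w (1 / 2) (K n) (norm w + 1) (\<delta> n) \<gamma>"
      by (rule area_approx_mono) (use \<delta> in auto)
    then show ?thesis by blast
  qed
  then obtain \<gamma>s where "\<And>n. area_approx \<iota> T w (1 / 2) (K n) (norm w + 1) (\<delta> n) (\<gamma>s n)" by metis
  then have lip: "\<exists>L. L-lipschitz_on {0..T} (\<gamma>s n)"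
    and hoelder: "0 \<le> s \<Longrightarrow> s \<le> t \<Longrightarrow> t \<le> T \<Longrightarrow> norm (\<gamma>s n t - \<gamma>s n s) \<le> K n * sqrt (t - s)"
    and area: "0 \<le> s \<Longrightarrow> s \<le> t \<Longrightarrow> t \<le> T \<Longrightarrow> norm (area \<iota> (\<gamma>s n) (s, t)) \<le> (norm w + 1) * (t - s)"
    and close: "0 \<le> s \<Longrightarrow> s \<le> t \<Longrightarrow> t \<le> T \<Longrightarrow>
      norm (area \<iota> (\<gamma>s n) (s, t) - ((t - s) / 2) *\<^sub>R w) \<le> \<delta> n" for n s t
    unfolding area_approx_def by simp_all
  define \<alpha> where "\<alpha> = (\<lambda>(s, t). ((t - s) / 2) *\<^sub>R w)"
  show ?thesis
  proof (rule that)
    show "\<gamma>s n \<in> C1var T" for n using lip[of n] lipschitz_C1var T by (metis less_imp_le)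
    have K0: "K n \<ge> 0" for n using \<delta>(1)[of n] by (simp add: K_def)
    have "pvar 2 T (increments (\<lambda>t. \<gamma>s n t - 0)) \<le> ennreal (((K n)\<^sup>2 * T) powr (1 / 2))" for n
    proof (rule pvar_le_of_powr_le)
      fix s t assume st: "0 \<le> s" "s < t" "t \<le> T"
      then have "(norm (\<gamma>s n t - \<gamma>s n s))\<^sup>2 \<le> (K n * sqrt (t - s))\<^sup>2"
        using hoelder[of s t n] by (intro power_mono) auto
      then show "norm (increments (\<lambda>t. \<gamma>s n t - 0) (s, t)) powr 2 \<le> (K n)\<^sup>2 * (t - s)"
        using st by (simp add: increments_def power_mult_distrib)
    qed (use T in auto)
    moreover have "(\<lambda>n. ((K n)\<^sup>2 * T) powr (1 / 2)) \<longlonglongrightarrow> 0"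
    proof (rule tendsto_zero_powrI[OF _ tendsto_const])
      have "(\<lambda>n. (2 * (norm a + norm b) * sqrt (\<delta> n) + \<delta> n)\<^sup>2 * T) \<longlonglongrightarrow>
          (2 * (norm a + norm b) * sqrt 0 + 0)\<^sup>2 * T"
        by (intro tendsto_intros \<delta>_lim)
      then show "(\<lambda>n. (K n)\<^sup>2 * T) \<longlonglongrightarrow> 0" by (simp add: K_def)
    qed (use T in auto)
    ultimately have "(\<lambda>n. pvar 2 T (increments (\<lambda>t. \<gamma>s n t - 0))) \<longlonglongrightarrow> 0"
      by (rule pvar_tendsto_zero)
    then show "path_conv_pvar 2 T \<gamma>s (\<lambda>_. 0)" by (simp add: path_conv_pvar_def)
    \<comment> \<open>\<open>R\<close> adds the slope \<open>norm w + 1\<close> of the bound on the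
      areas to the slope \<open>norm w / 2\<close> of the limit.\<close>
    define R where "R = norm w + 1 + norm w / 2"
    have R: "R \<ge> 0" by (simp add: R_def)
    have "pvar p T (\<lambda>x. area \<iota> (\<gamma>s n) x - \<alpha> x) \<le> ennreal ((\<delta> n powr (p - 1) * R * T) powr (1 / p))" for n
    proof (rule pvar_le_of_powr_le)
      fix s t assume st: "0 \<le> s" "s < t" "t \<le> T"
      define x where "x = norm (area \<iota> (\<gamma>s n) (s, t) - \<alpha> (s, t))"
      have "x \<le> \<delta> n" using close[of s t n] st by (simp add: x_def \<alpha>_def)
      moreover have "x \<le> R * (t - s)"
      proof -
        have "x \<le> norm (area \<iota> (\<gamma>s n) (s, t)) + norm (((t - s) / 2) *\<^sub>R w)"
          unfolding x_def \<alpha>_def split by (rule norm_triangle_ineq4)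
        also have "\<dots> \<le> (norm w + 1) * (t - s) + (t - s) / 2 * norm w"
          using area[of s t n] st by simp
        also have "\<dots> = R * (t - s)" by (simp add: R_def field_simps)
        finally show ?thesis .
      qed
      moreover have "x \<ge> 0" by (simp add: x_def)
      \<comment> \<open>Interpolation: the uniform bound is used for the power \<open>p - 1\<close>
        and the linear bound for the remaining factor. Since \<open>p > 1\<close>, the prefactor
        \<open>\<delta> n powr (p - 1)\<close> tends to zero.\<close>
      ultimately have "x powr (p - 1) * x \<le> \<delta> n powr (p - 1) * (R * (t - s))"
        using p by (intro mult_mono powr_mono2) auto
      moreover have "x powr p = x powr (p - 1) * x"
        using powr_mult_base[OF \<open>x \<ge> 0\<close>, of "p - 1"] by (simp add: mult.commute)
      ultimately show "norm (area \<iota> (\<gamma>s n) (s, t) - \<alpha> (s, t)) powr p \<le> \<delta> n powr (p - 1) * R * (t - s)"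
        by (simp add: x_def mult.assoc)
    qed (use p R T in auto)
    moreover have "(\<lambda>n. (\<delta> n powr (p - 1) * R * T) powr (1 / p)) \<longlonglongrightarrow> 0"
    proof (rule tendsto_zero_powrI[OF _ tendsto_const])
      have "(\<lambda>n. \<delta> n powr (p - 1)) \<longlonglongrightarrow> 0"
        by (rule tendsto_zero_powrI[OF \<delta>_lim tendsto_const]) (use p \<delta>(1) in \<open>auto intro: always_eventually less_imp_le\<close>)
      then have "(\<lambda>n. \<delta> n powr (p - 1) * R * T) \<longlonglongrightarrow> 0 * R * T" by (intro tendsto_intros)
      then show "(\<lambda>n. \<delta> n powr (p - 1) * R * T) \<longlonglongrightarrow> 0" by simp
    qed (use T R p in auto)
    ultimately have "(\<lambda>n. pvar p T (\<lambda>x. area \<iota> (\<gamma>s n) x - \<alpha> x)) \<longlonglongrightarrow> 0"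
      by (rule pvar_tendsto_zero)
    moreover have "continuous_on (triangle T) \<alpha>"
      unfolding \<alpha>_def split_def by (intro continuous_intros) auto
    moreover have "w \<in> span {tbracket \<iota> a b | a b. True}" unfolding w_def by (rule span_base) blast
    then have "\<alpha> x \<in> bracket_space \<iota>" for x
      unfolding bracket_space_def \<alpha>_def split_def using closure_subset span_scale by blast
    moreover have "\<alpha> (t, t) = 0" for t by (simp add: \<alpha>_def)
    ultimately have "conv_pvar p T (bracket_space \<iota>) (\<lambda>n. area \<iota> (\<gamma>s n)) \<alpha>"
      unfolding conv_pvar_def by blast
    then show "conv_pvar p T (bracket_space \<iota>) (\<lambda>n. area \<iota> (\<gamma>s n)) (\<lambda>(s, t). ((t - s) / 2) *\<^sub>R tbracket \<iota> a b)"
      by (simp add: \<alpha>_def w_def)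
  qed
qed

theorem mainTheorem6:
  fixes \<iota> :: "('v::banach, 'v) alg_tensor \<Rightarrow> 'w::banach" and T :: real
  assumes "2 \<le> vdim TYPE('v)"
    and "tensor_completion \<iota>"
    and "0 < T"
  shows "(\<forall>\<gamma>s \<gamma>s' :: nat \<Rightarrow> real \<Rightarrow> 'v. \<forall>\<gamma> \<alpha> \<alpha>'.
            (\<forall>n. \<gamma>s n \<in> C1var T) \<and> (\<forall>n. \<gamma>s' n \<in> C1var T) \<and>
            path_conv_pvar 2 T \<gamma>s \<gamma> \<and> path_conv_pvar 2 T \<gamma>s' \<gamma> \<and>
            conv_pvar 1 T (bracket_space \<iota>) (\<lambda>n. area \<iota> (\<gamma>s n)) \<alpha> \<and>
            conv_pvar 1 T (bracket_space \<iota>) (\<lambda>n. area \<iota> (\<gamma>s' n)) \<alpha>' \<longrightarrow>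
            (\<forall>x\<in>triangle T. \<alpha> x = \<alpha>' x)) \<and>
         (\<forall>p::real. p > 1 \<longrightarrow> (\<exists>\<gamma>s \<gamma>s' :: nat \<Rightarrow> real \<Rightarrow> 'v. \<exists>\<gamma> \<alpha> \<alpha>'.
            (\<forall>n. \<gamma>s n \<in> C1var T) \<and> (\<forall>n. \<gamma>s' n \<in> C1var T) \<and>
            path_conv_pvar 2 T \<gamma>s \<gamma> \<and> path_conv_pvar 2 T \<gamma>s' \<gamma> \<and>
            conv_pvar p T (bracket_space \<iota>) (\<lambda>n. area \<iota> (\<gamma>s n)) \<alpha> \<and>
            conv_pvar p T (bracket_space \<iota>) (\<lambda>n. area \<iota> (\<gamma>s' n)) \<alpha>' \<and>
            (\<exists>x\<in>triangle T. \<alpha> x \<noteq> \<alpha>' x)))"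
proof (rule conjI, goal_cases)
  case 1
  show ?case
  proof (intro allI impI ballI, elim conjE)
    fix \<gamma>s \<gamma>s' :: "nat \<Rightarrow> real \<Rightarrow> 'v" and \<gamma> \<alpha> \<alpha>' x
    assume \<gamma>s: "\<forall>n. \<gamma>s n \<in> C1var T" "\<forall>n. \<gamma>s' n \<in> C1var T"
      and \<gamma>: "path_conv_pvar 2 T \<gamma>s \<gamma>" "path_conv_pvar 2 T \<gamma>s' \<gamma>"
      and \<alpha>: "conv_pvar 1 T (bracket_space \<iota>) (\<lambda>n. area \<iota> (\<gamma>s n)) \<alpha>"
        "conv_pvar 1 T (bracket_space \<iota>) (\<lambda>n. area \<iota> (\<gamma>s' n)) \<alpha>'"
      and "x \<in> triangle T"
    then obtain s t where "x = (s, t)" "0 \<le> s" "s \<le> t" "t \<le> T" by (auto simp: triangle_def)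
    then show "\<alpha> x = \<alpha>' x"
      using area_closable_one_variation[OF assms(2) spec[OF \<gamma>s(1)] spec[OF \<gamma>s(2)] \<gamma> _ \<alpha>] by simp
  qed
next
  case 2
  show ?case
  proof (intro allI impI)
    fix p :: real assume p: "p > 1"
    obtain a b :: 'v where ab: "a \<noteq> b" "independent {a, b}"
      using exists_independent_pair[OF assms(1)] .
    obtain \<gamma>s where \<gamma>s: "\<And>n. \<gamma>s n \<in> C1var T" "path_conv_pvar 2 T \<gamma>s (\<lambda>_. 0)"
      "conv_pvar p T (bracket_space \<iota>) (\<lambda>n. area \<iota> (\<gamma>s n)) (\<lambda>(s, t). ((t - s) / 2) *\<^sub>R tbracket \<iota> a b)"
      using area_linear_limit[OF assms(2,3) p, where a = a and b = b] by blast
    have "p > 0" using p by simp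
    note zero = zero_path_converges[OF assms(2,3) this]
    have "(\<lambda>(s, t). ((t - s) / 2) *\<^sub>R tbracket \<iota> a b) (0, T) \<noteq> 0"
      using tbracket_nonzero[OF assms(2) ab] assms(3) by simp
    moreover have "(0, T) \<in> triangle T" using assms(3) by (simp add: triangle_def)
    ultimately have "\<exists>x\<in>triangle T. (\<lambda>(s, t). ((t - s) / 2) *\<^sub>R tbracket \<iota> a b) x \<noteq> 0" by blast
    then show "\<exists>\<gamma>s \<gamma>s' :: nat \<Rightarrow> real \<Rightarrow> 'v. \<exists>\<gamma> \<alpha> \<alpha>'.
            (\<forall>n. \<gamma>s n \<in> C1var T) \<and> (\<forall>n. \<gamma>s' n \<in> C1var T) \<and>
            path_conv_pvar 2 T \<gamma>s \<gamma> \<and> path_conv_pvar 2 T \<gamma>s' \<gamma> \<and>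
            conv_pvar p T (bracket_space \<iota>) (\<lambda>n. area \<iota> (\<gamma>s n)) \<alpha> \<and>
            conv_pvar p T (bracket_space \<iota>) (\<lambda>n. area \<iota> (\<gamma>s' n)) \<alpha>' \<and>
            (\<exists>x\<in>triangle T. \<alpha> x \<noteq> \<alpha>' x)"
      using \<gamma>s zero by (intro exI[of _ \<gamma>s] exI[of _ "\<lambda>_ _. 0"] exI[of _ "\<lambda>_. 0"]
          exI[of _ "\<lambda>(s, t). ((t - s) / 2) *\<^sub>R tbracket \<iota> a b"] conjI allI) assumption+
  qed
qed

end
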